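(* The following hold. (i) $\mathrm{H}^+(\mathbb{R}) = R_2(\mathrm{H}^+(\mathbb{R}))$ and $\mathrm{H}(\mathbb{R}) = R_2(\mathrm{H}(\mathbb{R}))$. (ii) For each positive integer $n$, the set $R_n(\mathrm{PLF}^+(\mathbb{R}))$ contains only the identity element, and $I_{2n}(\mathrm{PLF}(\mathbb{R})) = R_n(\mathrm{PLF}(\mathbb{R}))$. (iii) $\mathrm{PL}^+(\mathbb{R}) = R_4(\mathrm{PL}^+(\mathbb{R}))$ and $\mathrm{PL}(\mathbb{R}) = R_2(\mathrm{PL}(\mathbb{R}))$.
   Context: $\mathrm{H}(\mathbb{R})$ is the group (under composition) of all homeomorphisms of $\mathbb{R}$. $\mathrm{PLF}(\mathbb{R})$ is the subgroup of piecewise linear homeomorphisms of $\mathbb{R}$ that are locally affine at all but a finite number of points of $\mathbb{R}$. $\mathrm{PL}(\mathbb{R})$ is the subgroup of piecewise linear homeomorphisms of $\mathbb{R}$ that are locally affine at all but a discrete set of points of $\mathbb{R}$. A superscript $+$ denotes the index-$2$ subgroup of orientation preserving (strictly increasing) elements. Let $G$ be a group. An element $g\in G$ is reversible in $G$ if there is $h\in G$ with $hgh^{-1}=g^{-1}$. An involution in $G$ is an element whose square is the identity (so the identity counts as an involution). For $n=1,2,\dots$, $R_n(G)$ is the set of all products $g_1g_2\cdots g_n$ with each $g_i$ reversible in $G$, and $I_n(G)$ is the set of all products $\tau_1\tau_2\cdots\tau_n$ with each $\tau_i$ an involution in $G$. *)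

theory Defs
  imports "HOL-Analysis.Analysis" "HOL-Algebra.Group"
begin

definition reversible :: "('a, 'b) monoid_scheme \<Rightarrow> 'a \<Rightarrow> bool" where
  "reversible G g \<longleftrightarrow>
     g \<in> carrier G \<and>
     (\<exists>h\<in>carrier G. h \<otimes>\<^bsub>G\<^esub> g \<otimes>\<^bsub>G\<^esub> inv\<^bsub>G\<^esub> h = inv\<^bsub>G\<^esub> g)"

definition involution :: "('a, 'b) monoid_scheme \<Rightarrow> 'a \<Rightarrow> bool" where
  "involution G g \<longleftrightarrow> g \<in> carrier G \<and> g \<otimes>\<^bsub>G\<^esub> g = \<one>\<^bsub>G\<^esub>"

text \<open>The number of factors is exactly \<open>n\<close>; only \<open>n \<ge> 1\<close> is of interest.\<close>

definition reversible_products :: "('a, 'b) monoid_scheme \<Rightarrow> nat \<Rightarrow> 'a set" where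
  "reversible_products G n =
     {foldr (\<otimes>\<^bsub>G\<^esub>) gs \<one>\<^bsub>G\<^esub> | gs. length gs = n \<and> (\<forall>g\<in>set gs. reversible G g)}"

definition involution_products :: "('a, 'b) monoid_scheme \<Rightarrow> nat \<Rightarrow> 'a set" where
  "involution_products G n =
     {foldr (\<otimes>\<^bsub>G\<^esub>) ts \<one>\<^bsub>G\<^esub> | ts. length ts = n \<and> (\<forall>t\<in>set ts. involution G t)}"

definition homeo_R :: "(real \<Rightarrow> real) monoid" where
  "homeo_R = \<lparr>carrier = {f. \<exists>g. homeomorphism UNIV UNIV f g}, mult = (\<circ>), one = id\<rparr>"

definition locally_affine_at :: "(real \<Rightarrow> real) \<Rightarrow> real \<Rightarrow> bool" where
  "locally_affine_at f x \<longleftrightarrow> (\<exists>a b. \<forall>\<^sub>F y in nhds x. f y = a * y + b)"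

definition PLF_R :: "(real \<Rightarrow> real) monoid" where
  "PLF_R = homeo_R\<lparr>carrier := {f \<in> carrier homeo_R. finite {x. \<not> locally_affine_at f x}}\<rparr>"

text \<open>
  Since \<open>{x. \<not> locally_affine_at f x}\<close> is always closed, it is discrete as a subspace
  iff it has no limit point in the real line (see \<open>discrete_breaks_iff\<close> below), so both
  readings of ``discrete set of points'' agree.
\<close>

definition PL_R :: "(real \<Rightarrow> real) monoid" where
  "PL_R = homeo_R\<lparr>carrier := {f \<in> carrier homeo_R. discrete {x. \<not> locally_affine_at f x}}\<rparr>"

definition orientation_preserving :: "(real \<Rightarrow> real) monoid \<Rightarrow> (real \<Rightarrow> real) monoid" where
  "orientation_preserving G = G\<lparr>carrier := {f \<in> carrier G. strict_mono f}\<rparr>"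

lemma homeo_R_simps [simp]:
  "mult homeo_R = (\<circ>)" "one homeo_R = id"
  "f \<in> carrier homeo_R \<longleftrightarrow> (\<exists>g. homeomorphism UNIV UNIV f g)"
  by (auto simp: homeo_R_def)

lemma group_homeo_R: "group homeo_R"
proof (rule groupI)
  show "f \<otimes>\<^bsub>homeo_R\<^esub> g \<in> carrier homeo_R"
    if "f \<in> carrier homeo_R" "g \<in> carrier homeo_R" for f g
    using that by (auto intro: homeomorphism_compose)
  show "\<one>\<^bsub>homeo_R\<^esub> \<in> carrier homeo_R"
    by (auto intro!: exI[of _ id] simp: homeomorphism_def)
  show "\<exists>g\<in>carrier homeo_R. g \<otimes>\<^bsub>homeo_R\<^esub> f = \<one>\<^bsub>homeo_R\<^esub>" if f: "f \<in> carrier homeo_R" for f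
  proof -
    obtain g where "homeomorphism UNIV UNIV f g" using f by auto
    then show ?thesis
      by (intro bexI[of _ g]) (auto simp: fun_eq_iff homeomorphism_def)
  qed
qed (auto simp: o_assoc)

lemma inv_homeo_R:
  assumes "homeomorphism UNIV UNIV f g"
  shows "inv\<^bsub>homeo_R\<^esub> f = g"
proof -
  interpret group homeo_R by (rule group_homeo_R)
  show ?thesis
    using assms homeomorphism_symD[OF assms]
    by (intro inv_equality) (auto simp: fun_eq_iff homeomorphism_def)
qed

lemma open_locally_affine: "open {x. locally_affine_at f x}"
proof (subst open_subopen, safe)
  fix x assume "locally_affine_at f x"
  then obtain a b T where "open T" "x \<in> T" "\<forall>y\<in>T. f y = a * y + b"
    unfolding locally_affine_at_def eventually_nhds by blast
  then show "\<exists>T. open T \<and> x \<in> T \<and> T \<subseteq> {x. locally_affine_at f x}"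
    unfolding locally_affine_at_def eventually_nhds by blast
qed

lemma discrete_breaks_iff:
  "discrete {x. \<not> locally_affine_at f x} \<longleftrightarrow>
     (\<forall>x. \<forall>\<^sub>F y in at x. locally_affine_at f y)"
proof
  assume d: "discrete {x. \<not> locally_affine_at f x}"
  show "\<forall>x. \<forall>\<^sub>F y in at x. locally_affine_at f y"
  proof
    fix x show "\<forall>\<^sub>F y in at x. locally_affine_at f y"
    proof (cases "locally_affine_at f x")
      case True
      then show ?thesis
        using open_locally_affine[of f] by (auto simp: eventually_at_topological)
    next
      case False
      then show ?thesis
        using d by (auto simp: discrete_def isolated_in_altdef)
    qed
  qed
qed (auto simp: discrete_def isolated_in_altdef)

lemma locally_affine_at_comp:
  assumes "continuous_on UNIV g" "locally_affine_at g x" "locally_affine_at f (g x)"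
  shows "locally_affine_at (f \<circ> g) x"
proof -
  obtain a b where 1: "\<forall>\<^sub>F y in nhds x. g y = a * y + b"
    using assms(2) unfolding locally_affine_at_def by blast
  obtain c d where 2: "\<forall>\<^sub>F y in nhds (g x). f y = c * y + d"
    using assms(3) unfolding locally_affine_at_def by blast
  have "filterlim g (nhds (g x)) (nhds x)"
    using assms(1) by (simp add: continuous_on_eq_continuous_at isCont_def tendsto_at_iff_tendsto_nhds)
  with 2 have "\<forall>\<^sub>F y in nhds x. f (g y) = c * g y + d"
    by (rule eventually_compose_filterlim)
  with 1 have "\<forall>\<^sub>F y in nhds x. (f \<circ> g) y = (c * a) * y + (c * b + d)"
    by eventually_elim (simp add: algebra_simps)
  then show ?thesis unfolding locally_affine_at_def by blast
qed

lemma locally_affine_at_inverse: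
  assumes h: "homeomorphism UNIV UNIV f g" and "locally_affine_at f (g y)"
  shows "locally_affine_at g y"
proof -
  obtain a b where 1: "\<forall>\<^sub>F t in nhds (g y). f t = a * t + b"
    using assms(2) unfolding locally_affine_at_def by blast
  have "filterlim g (nhds (g y)) (nhds y)"
    using h by (simp add: homeomorphism_def continuous_on_eq_continuous_at isCont_def
        tendsto_at_iff_tendsto_nhds)
  with 1 have "\<forall>\<^sub>F z in nhds y. f (g z) = a * g z + b"
    by (rule eventually_compose_filterlim)
  then have ev: "\<forall>\<^sub>F z in nhds y. z = a * g z + b"
    using h by (simp add: homeomorphism_def)
  have "a \<noteq> 0"
  proof
    assume "a = 0"
    with ev have "\<forall>\<^sub>F z in nhds y. z = b" by simp
    then obtain T where "open T" "y \<in> T" "T \<subseteq> {b}"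
      unfolding eventually_nhds by blast
    then show False
      using not_open_singleton[of b] by (metis empty_iff subset_singletonD)
  qed
  then have "\<forall>\<^sub>F z in nhds y. g z = (1 / a) * z + (- b / a)"
    using ev by (auto elim!: eventually_mono simp: field_simps)
  then show ?thesis unfolding locally_affine_at_def by blast
qed

lemma locally_affine_at_id: "locally_affine_at id x"
  unfolding locally_affine_at_def by (intro exI[of _ 1] exI[of _ 0]) simp

lemma homeomorphism_filterlim_at:
  fixes f g :: "real \<Rightarrow> real"
  assumes "homeomorphism UNIV UNIV f g"
  shows "filterlim f (at (f x)) (at x)"
proof -
  have "(f \<longlongrightarrow> f x) (at x)"
    using assms by (simp add: homeomorphism_def continuous_on_eq_continuous_at isCont_def)
  moreover have "\<forall>\<^sub>F y in at x. f y \<noteq> f x"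
    using assms unfolding eventually_at_filter homeomorphism_def
    by (intro always_eventually) (metis UNIV_I)
  ultimately show ?thesis by (simp add: filterlim_at)
qed

lemma subgroup_PLF_R: "subgroup (carrier PLF_R) homeo_R"
proof -
  interpret group homeo_R by (rule group_homeo_R)
  show ?thesis
  proof (rule subgroupI)
    show "carrier PLF_R \<subseteq> carrier homeo_R" by (auto simp: PLF_R_def)
    have "\<one>\<^bsub>homeo_R\<^esub> \<in> carrier PLF_R"
      using one_closed unfolding PLF_R_def by (simp add: locally_affine_at_id)
    then show "carrier PLF_R \<noteq> {}" by blast
  next
    fix f assume f: "f \<in> carrier PLF_R"
    then obtain g where g: "homeomorphism UNIV UNIV f g" by (auto simp: PLF_R_def)
    have "{y. \<not> locally_affine_at g y} \<subseteq> f ` {x. \<not> locally_affine_at f x}"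
    proof
      fix y assume "y \<in> {y. \<not> locally_affine_at g y}"
      then have "\<not> locally_affine_at f (g y)" using locally_affine_at_inverse[OF g] by auto
      moreover have "y = f (g y)" using g by (simp add: homeomorphism_def)
      ultimately show "y \<in> f ` {x. \<not> locally_affine_at f x}" by blast
    qed
    then have "finite {y. \<not> locally_affine_at g y}"
      using f by (auto simp: PLF_R_def intro: finite_subset)
    then show "inv\<^bsub>homeo_R\<^esub> f \<in> carrier PLF_R"
      using homeomorphism_symD[OF g] by (auto simp: inv_homeo_R[OF g] PLF_R_def)
  next
    fix f g assume fg: "f \<in> carrier PLF_R" "g \<in> carrier PLF_R"
    then obtain g' where g': "homeomorphism UNIV UNIV g g'" by (auto simp: PLF_R_def)
    have "{x. \<not> locally_affine_at (f \<circ> g) x} \<subseteq>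
        {x. \<not> locally_affine_at g x} \<union> g' ` {x. \<not> locally_affine_at f x}"
    proof
      fix x assume x: "x \<in> {x. \<not> locally_affine_at (f \<circ> g) x}"
      have "x = g' (g x)" using g' by (simp add: homeomorphism_def)
      moreover have "\<not> locally_affine_at g x \<or> \<not> locally_affine_at f (g x)"
        using x locally_affine_at_comp[of g x f] g' by (auto simp: homeomorphism_def)
      ultimately show "x \<in> {x. \<not> locally_affine_at g x} \<union> g' ` {x. \<not> locally_affine_at f x}"
        by blast
    qed
    then have "finite {x. \<not> locally_affine_at (f \<circ> g) x}"
      using fg by (auto simp: PLF_R_def intro: finite_subset)
    moreover have "f \<otimes>\<^bsub>homeo_R\<^esub> g \<in> carrier homeo_R"
      using fg by (intro m_closed) (auto simp: PLF_R_def)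
    ultimately show "f \<otimes>\<^bsub>homeo_R\<^esub> g \<in> carrier PLF_R" by (simp add: PLF_R_def)
  qed
qed

lemma subgroup_PL_R: "subgroup (carrier PL_R) homeo_R"
proof -
  interpret group homeo_R by (rule group_homeo_R)
  show ?thesis
  proof (rule subgroupI)
    show "carrier PL_R \<subseteq> carrier homeo_R" by (auto simp: PL_R_def)
    have "\<one>\<^bsub>homeo_R\<^esub> \<in> carrier PL_R"
      using one_closed unfolding PL_R_def by (simp add: locally_affine_at_id)
    then show "carrier PL_R \<noteq> {}" by blast
  next
    fix f assume f: "f \<in> carrier PL_R"
    then obtain g where g: "homeomorphism UNIV UNIV f g" by (auto simp: PL_R_def)
    have "\<forall>\<^sub>F y in at z. locally_affine_at g y" for z
    proof -
      have "\<forall>\<^sub>F x in at (g z). locally_affine_at f x"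
        using f by (auto simp: PL_R_def discrete_breaks_iff)
      then have "\<forall>\<^sub>F y in at z. locally_affine_at f (g y)"
        using homeomorphism_filterlim_at[OF homeomorphism_symD[OF g]]
        by (rule eventually_compose_filterlim)
      then show ?thesis
        by eventually_elim (rule locally_affine_at_inverse[OF g])
    qed
    then show "inv\<^bsub>homeo_R\<^esub> f \<in> carrier PL_R"
      using homeomorphism_symD[OF g] by (auto simp: inv_homeo_R[OF g] PL_R_def discrete_breaks_iff)
  next
    fix f g assume fg: "f \<in> carrier PL_R" "g \<in> carrier PL_R"
    then obtain g' where g': "homeomorphism UNIV UNIV g g'" by (auto simp: PL_R_def)
    have "\<forall>\<^sub>F y in at z. locally_affine_at (f \<circ> g) y" for z
    proof -
      have "\<forall>\<^sub>F y in at (g z). locally_affine_at f y"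
        using fg by (auto simp: PL_R_def discrete_breaks_iff)
      then have "\<forall>\<^sub>F y in at z. locally_affine_at f (g y)"
        using homeomorphism_filterlim_at[OF g'] by (rule eventually_compose_filterlim)
      moreover have "\<forall>\<^sub>F y in at z. locally_affine_at g y"
        using fg by (auto simp: PL_R_def discrete_breaks_iff)
      ultimately show ?thesis
        by eventually_elim (use g' in \<open>auto simp: homeomorphism_def intro!: locally_affine_at_comp\<close>)
    qed
    moreover have "f \<otimes>\<^bsub>homeo_R\<^esub> g \<in> carrier homeo_R"
      using fg by (intro m_closed) (auto simp: PL_R_def)
    ultimately show "f \<otimes>\<^bsub>homeo_R\<^esub> g \<in> carrier PL_R" by (simp add: PL_R_def discrete_breaks_iff)
  qed
qed

lemma subgroup_strict_mono: "subgroup {f \<in> carrier homeo_R. strict_mono f} homeo_R"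
proof -
  interpret group homeo_R by (rule group_homeo_R)
  show ?thesis
  proof (rule subgroupI)
    have "\<one>\<^bsub>homeo_R\<^esub> \<in> {f \<in> carrier homeo_R. strict_mono f}"
      using one_closed by (simp add: strict_mono_def)
    then show "{f \<in> carrier homeo_R. strict_mono f} \<noteq> {}" by blast
  next
    fix f assume "f \<in> {f \<in> carrier homeo_R. strict_mono f}"
    then obtain g where f: "strict_mono f" and g: "homeomorphism UNIV UNIV f g" by auto
    have "g x < g y" if "x < y" for x y
    proof -
      have "f (g x) < f (g y)" using that g by (simp add: homeomorphism_def)
      then show ?thesis using strict_mono_less[OF f] by simp
    qed
    then show "inv\<^bsub>homeo_R\<^esub> f \<in> {f \<in> carrier homeo_R. strict_mono f}"
      using homeomorphism_symD[OF g] by (auto simp: inv_homeo_R[OF g] strict_mono_def)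
  next
    fix f g assume fg: "f \<in> {f \<in> carrier homeo_R. strict_mono f}"
      "g \<in> {f \<in> carrier homeo_R. strict_mono f}"
    have "f \<otimes>\<^bsub>homeo_R\<^esub> g \<in> carrier homeo_R"
      using fg by (intro m_closed) auto
    then show "f \<otimes>\<^bsub>homeo_R\<^esub> g \<in> {f \<in> carrier homeo_R. strict_mono f}"
      using fg by (auto simp: strict_mono_def)
  qed auto
qed

lemma group_PLF_R: "group PLF_R"
  using group.subgroup_imp_group[OF group_homeo_R subgroup_PLF_R] by (simp add: PLF_R_def)

lemma group_PL_R: "group PL_R"
  using group.subgroup_imp_group[OF group_homeo_R subgroup_PL_R] by (simp add: PL_R_def)

lemma group_orientation_preserving:
  assumes "subgroup A homeo_R"
  shows "group (orientation_preserving (homeo_R\<lparr>carrier := A\<rparr>))"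
proof -
  have "subgroup (A \<inter> {f \<in> carrier homeo_R. strict_mono f}) homeo_R"
    using group.subgroups_Inter_pair[OF group_homeo_R assms subgroup_strict_mono] .
  moreover have "A \<inter> {f \<in> carrier homeo_R. strict_mono f} = {f \<in> A. strict_mono f}"
    using subgroup.subset[OF assms] by blast
  ultimately show ?thesis
    using group.subgroup_imp_group[OF group_homeo_R]
    by (simp add: orientation_preserving_def)
qed

lemma groups_orientation_preserving:
  "group (orientation_preserving homeo_R)"
  "group (orientation_preserving PLF_R)"
  "group (orientation_preserving PL_R)"
  using group_orientation_preserving[OF group.subgroup_self[OF group_homeo_R]]
    group_orientation_preserving[OF subgroup_PLF_R]
    group_orientation_preserving[OF subgroup_PL_R]
  by (simp_all add: PLF_R_def PL_R_def)

end

theory Submission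
  imports Defs
begin

text \<open>
  An element \<open>g\<close> is reversible iff \<open>g h g = h\<close> for some \<open>h\<close>. An increasing homeomorphism
  without fixed points is conjugate to a translation, inside PL if it belongs to PL, and the
  reflection reverses the translation. In H and PL every increasing \<open>f\<close> is a product of two
  fixed point free maps, one of them lying above both \<open>f\<close> and the identity; a decreasing \<open>f\<close> is
  an involution times such a map. The translation is also a product of two elements reversible in
  PL+, both conjugate to one periodic PL map with a repelling and an attracting fixed point per
  period. This gives \<open>R\<^sub>4\<close> for PL+; conjugating the factorisation to every component of the set
  of points moved by \<open>f\<close> gives \<open>R\<^sub>2\<close> for H+.

  In PLF, if \<open>f h f = h\<close> then \<open>f h\<close> and \<open>h\<close> have the same square. Increasing square roots are
  unique in PLF, since along an unbounded sequence of fundamental domains all but finitely many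
  contain no break point; so only the identity is reversible in PLF+. If \<open>h\<close> is decreasing with
  fixed point \<open>q\<close>, then \<open>h\<close> on the right of \<open>q\<close> and \<open>h\<inverse>\<close> on the left of \<open>q\<close> form an
  involution that reverses \<open>f\<close> as well.
\<close>

subsection \<open>Reversible elements and involutions\<close>

context group
begin

text \<open>Multiplying by \<open>g\<close> on the left and by \<open>h\<close> on the right clears
  both inverses, so in a group of maps reversibility becomes a pointwise identity.\<close>

lemma reversible_iff:
  "reversible G g \<longleftrightarrow> g \<in> carrier G \<and> (\<exists>h\<in>carrier G. g \<otimes> h \<otimes> g = h)"
proof -
  have "h \<otimes> g \<otimes> inv h = inv g \<longleftrightarrow> g \<otimes> h \<otimes> g = h"
    if g: "g \<in> carrier G" and h: "h \<in> carrier G" for h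
  proof
    have "g \<otimes> h \<otimes> g = g \<otimes> (h \<otimes> g \<otimes> inv h) \<otimes> h"
      using g h by (simp add: m_assoc)
    then show "g \<otimes> h \<otimes> g = h" if "h \<otimes> g \<otimes> inv h = inv g"
      using that g h by simp
    have "h \<otimes> g \<otimes> inv h = inv g \<otimes> (g \<otimes> h \<otimes> g) \<otimes> inv h"
      using g h by (simp add: m_assoc inv_solve_left)
    then show "h \<otimes> g \<otimes> inv h = inv g" if "g \<otimes> h \<otimes> g = h"
      using that g h by (simp add: m_assoc)
  qed
  then show ?thesis unfolding reversible_def by blast
qed

lemma involution_imp_reversible:
  assumes "involution G t"
  shows "reversible G t"
  using assms unfolding reversible_iff involution_def by (intro conjI bexI[of _ \<one>]) auto

text \<open>The factor \<open>s\<close> is itself a reverser: conjugation by \<open>s\<close> turns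
  the product into \<open>t \<otimes> s\<close>, its inverse.\<close>

lemma involution_mult_imp_reversible:
  assumes "involution G s" "involution G t"
  shows "reversible G (s \<otimes> t)"
proof -
  have st: "s \<in> carrier G" "t \<in> carrier G" "s \<otimes> s = \<one>" "t \<otimes> t = \<one>"
    using assms by (auto simp: involution_def)
  have "s \<otimes> t \<otimes> s \<otimes> (s \<otimes> t) = s \<otimes> t \<otimes> (s \<otimes> s) \<otimes> t"
    using st(1,2) by (simp add: m_assoc)
  also have "\<dots> = s \<otimes> (t \<otimes> t)"
    using st(1,2) by (simp add: m_assoc st(3))
  finally have "s \<otimes> t \<otimes> s \<otimes> (s \<otimes> t) = s" using st by simp
  with st show ?thesis unfolding reversible_iff by (intro conjI bexI[of _ s]) auto
qed

lemma reversible_products_subset: "reversible_products G n \<subseteq> carrier G"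
proof -
  have "foldr (\<otimes>) gs \<one> \<in> carrier G" if "\<forall>g\<in>set gs. reversible G g" for gs
    using that by (induction gs) (auto simp: reversible_def)
  then show ?thesis by (auto simp: reversible_products_def)
qed

lemma reversible_products_0: "reversible_products G 0 = {\<one>}"
  by (auto simp: reversible_products_def)

lemma reversible_products_Suc:
  "reversible_products G (Suc n) = {g \<otimes> x | g x. reversible G g \<and> x \<in> reversible_products G n}"
proof (intro equalityI subsetI)
  fix y assume "y \<in> {g \<otimes> x | g x. reversible G g \<and> x \<in> reversible_products G n}"
  then obtain g gs where "y = foldr (\<otimes>) (g # gs) \<one>" "length (g # gs) = Suc n"
      "\<forall>g\<in>set (g # gs). reversible G g"
    by (auto simp: reversible_products_def)
  then show "y \<in> reversible_products G (Suc n)" unfolding reversible_products_def by blast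
next
  fix y assume "y \<in> reversible_products G (Suc n)"
  then obtain g gs where "y = g \<otimes> foldr (\<otimes>) gs \<one>" "length gs = n"
      "reversible G g" "\<forall>g\<in>set gs. reversible G g"
    by (auto simp: reversible_products_def length_Suc_conv)
  then show "y \<in> {g \<otimes> x | g x. reversible G g \<and> x \<in> reversible_products G n}"
    unfolding reversible_products_def by blast
qed

lemma involution_products_0: "involution_products G 0 = {\<one>}"
  by (auto simp: involution_products_def)

lemma involution_products_Suc:
  "involution_products G (Suc n) = {g \<otimes> x | g x. involution G g \<and> x \<in> involution_products G n}"
proof (intro equalityI subsetI)
  fix y assume "y \<in> {g \<otimes> x | g x. involution G g \<and> x \<in> involution_products G n}"
  then obtain g gs where "y = foldr (\<otimes>) (g # gs) \<one>" "length (g # gs) = Suc n"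
      "\<forall>g\<in>set (g # gs). involution G g"
    by (auto simp: involution_products_def)
  then show "y \<in> involution_products G (Suc n)" unfolding involution_products_def by blast
next
  fix y assume "y \<in> involution_products G (Suc n)"
  then obtain g gs where "y = g \<otimes> foldr (\<otimes>) gs \<one>" "length gs = n"
      "involution G g" "\<forall>g\<in>set gs. involution G g"
    by (auto simp: involution_products_def length_Suc_conv)
  then show "y \<in> {g \<otimes> x | g x. involution G g \<and> x \<in> involution_products G n}"
    unfolding involution_products_def by blast
qed

lemma mult_mem_reversible_products_2:
  assumes "reversible G a" "reversible G b"
  shows "a \<otimes> b \<in> reversible_products G 2"
proof -
  have "foldr (\<otimes>) [a, b] \<one> = a \<otimes> b" using assms by (simp add: reversible_def)
  with assms show ?thesis
    unfolding reversible_products_def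
    by (intro CollectI exI[of _ "[a, b]"]) auto
qed

lemma mult_mem_reversible_products_4:
  assumes "reversible G a" "reversible G b" "reversible G c" "reversible G d"
  shows "(a \<otimes> b) \<otimes> (c \<otimes> d) \<in> reversible_products G 4"
proof -
  have "foldr (\<otimes>) [a, b, c, d] \<one> = (a \<otimes> b) \<otimes> (c \<otimes> d)"
    using assms by (simp add: reversible_def m_assoc)
  with assms show ?thesis
    unfolding reversible_products_def
    by (intro CollectI exI[of _ "[a, b, c, d]"]) auto
qed

text \<open>Two adjacent involutions merge into one reversible element; the hypothesis provides the
  opposite splitting.\<close>

lemma involution_products_eq_reversible_products:
  assumes "\<And>g. reversible G g \<Longrightarrow> \<exists>s t. involution G s \<and> involution G t \<and> g = s \<otimes> t"
  shows "involution_products G (2 * n) = reversible_products G n"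
proof (induction n)
  case 0
  show ?case by (simp add: involution_products_0 reversible_products_0)
next
  case (Suc n)
  have *: "2 * Suc n = Suc (Suc (2 * n))" by simp
  have mem: "x \<in> carrier G" if "x \<in> reversible_products G n" for x
    using that reversible_products_subset by blast
  show ?case
  proof (intro equalityI subsetI)
    fix y assume "y \<in> involution_products G (2 * Suc n)"
    then obtain s t x where y: "y = s \<otimes> (t \<otimes> x)" and st: "involution G s" "involution G t"
        and x: "x \<in> reversible_products G n"
      unfolding * involution_products_Suc Suc.IH by auto
    have "y = s \<otimes> t \<otimes> x"
      using y st mem[OF x] by (simp add: involution_def m_assoc)
    then show "y \<in> reversible_products G (Suc n)"
      using involution_mult_imp_reversible[OF st] x unfolding reversible_products_Suc by blast
  next
    fix y assume "y \<in> reversible_products G (Suc n)"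
    then obtain g x where y: "y = g \<otimes> x" and g: "reversible G g" and x: "x \<in> reversible_products G n"
      unfolding reversible_products_Suc by auto
    obtain s t where st: "involution G s" "involution G t" "g = s \<otimes> t" using assms[OF g] by blast
    have "y = s \<otimes> (t \<otimes> x)"
      using y st mem[OF x] by (simp add: involution_def m_assoc)
    then show "y \<in> involution_products G (2 * Suc n)"
      using st x unfolding * involution_products_Suc Suc.IH by blast
  qed
qed

end

text \<open>A common frame for H, PL, PLF and their increasing subgroups: the product is always
  composition, and only the carrier varies.\<close>

locale homeo_group =
  fixes G :: "(real \<Rightarrow> real) monoid"
  assumes subgroup_homeo_R: "subgroup (carrier G) homeo_R"
    and mult_eq [simp]: "mult G = (\<circ>)"
    and one_eq [simp]: "one G = id"
begin

lemma eq_homeo_R_update: "G = homeo_R\<lparr>carrier := carrier G\<rparr>"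
  by (rule monoid.equality) auto

sublocale group G
  using group.subgroup_imp_group[OF group_homeo_R subgroup_homeo_R] eq_homeo_R_update by simp

lemma comp_closed: "f \<in> carrier G \<Longrightarrow> g \<in> carrier G \<Longrightarrow> f \<circ> g \<in> carrier G"
  using m_closed[of f g] by simp

lemma id_closed: "id \<in> carrier G"
  using one_closed by simp

lemma homeomorphismE:
  assumes "f \<in> carrier G"
  obtains g where "homeomorphism UNIV UNIV f g" "g \<in> carrier G"
proof -
  have "f \<in> carrier homeo_R" using subgroup.subset[OF subgroup_homeo_R] assms by blast
  then obtain g where g: "homeomorphism UNIV UNIV f g" by auto
  have "g \<in> carrier G"
    using subgroup.m_inv_closed[OF subgroup_homeo_R assms] inv_homeo_R[OF g] by simp
  with g that show ?thesis by blast
qed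

lemma inverseE:
  assumes "f \<in> carrier G"
  obtains g where "g \<in> carrier G" "\<And>x. g (f x) = x" "\<And>x. f (g x) = x"
proof -
  obtain g where "homeomorphism UNIV UNIV f g" "g \<in> carrier G" using homeomorphismE[OF assms] .
  then show ?thesis using that by (simp add: homeomorphism_def)
qed

lemma continuous: "f \<in> carrier G \<Longrightarrow> continuous_on A f"
  by (metis homeomorphismE homeomorphism_cont1 continuous_on_subset top_greatest)

lemma reversibleI:
  assumes "g \<in> carrier G" "h \<in> carrier G" "\<And>x. g (h (g x)) = h x"
  shows "reversible G g"
  unfolding reversible_iff using assms by (intro conjI bexI[of _ h]) auto

lemma reversibleE:
  assumes "reversible G g"
  obtains h where "g \<in> carrier G" "h \<in> carrier G" "\<And>x. g (h (g x)) = h x"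
  using assms unfolding reversible_iff by (auto simp: fun_eq_iff)

end

lemma homeo_group_homeo_R: "homeo_group homeo_R"
  using group.subgroup_self[OF group_homeo_R] by (rule homeo_group.intro) simp_all

lemma homeo_group_PLF_R: "homeo_group PLF_R"
  by (rule homeo_group.intro[OF subgroup_PLF_R]) (auto simp: PLF_R_def)

lemma homeo_group_PL_R: "homeo_group PL_R"
  by (rule homeo_group.intro[OF subgroup_PL_R]) (auto simp: PL_R_def)

section \<open>Increasing and decreasing homeomorphisms\<close>

lemma carrier_orientation_preserving [simp]:
  "f \<in> carrier (orientation_preserving G) \<longleftrightarrow> f \<in> carrier G \<and> strict_mono f"
  by (simp add: orientation_preserving_def)

lemma homeo_group_orientation_preserving:
  assumes "homeo_group G"
  shows "homeo_group (orientation_preserving G)"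
proof -
  interpret homeo_group G by fact
  have "carrier G \<inter> {f \<in> carrier homeo_R. strict_mono f} = {f \<in> carrier G. strict_mono f}"
    using subgroup.subset[OF subgroup_homeo_R] by blast
  then have "subgroup {f \<in> carrier G. strict_mono f} homeo_R"
    using group.subgroups_Inter_pair[OF group_homeo_R subgroup_homeo_R subgroup_strict_mono] by simp
  then show ?thesis
    by (intro homeo_group.intro) (simp_all add: orientation_preserving_def)
qed

text \<open>A monotone surjection has no jumps, so continuity of the map and of its inverse is
  automatic.\<close>

lemma strict_mono_surj_homeo_R:
  fixes f :: "real \<Rightarrow> real"
  assumes f: "strict_mono f" and surj: "\<And>y. f (g y) = y"
  shows "f \<in> carrier homeo_R"
proof -
  have gf: "g (f x) = x" for x
    using surj[of "f x"] strict_mono_eq[OF f] by blast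
  have g: "strict_mono g"
    by (intro strict_monoI) (metis surj strict_mono_less[OF f])
  have [simp]: "range f = UNIV" "range g = UNIV"
    using gf surj by (auto intro!: surjI)
  have "continuous_on UNIV f" "continuous_on UNIV g"
    using strict_mono_less_eq[OF f] strict_mono_less_eq[OF g]
    by (auto intro!: continuous_onI_mono)
  then have "homeomorphism UNIV UNIV f g" using gf surj by (simp add: homeomorphism_def)
  then show ?thesis by auto
qed

lemma strict_mono_or_antimono:
  assumes "f \<in> carrier homeo_R"
  shows "strict_mono f \<or> strict_antimono_on UNIV f"
proof -
  obtain g where "homeomorphism UNIV UNIV f g" using assms by auto
  then have "continuous_on UNIV f" "inj f"
    by (auto simp: homeomorphism_def intro: inj_on_inverseI)
  then show ?thesis using injective_eq_monotone_map[of UNIV f] by simp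
qed

lemma strict_antimono_less:
  fixes f :: "real \<Rightarrow> real"
  assumes "strict_antimono_on UNIV f"
  shows "f x < f y \<longleftrightarrow> y < x"
  using assms unfolding monotone_on_def by (metis UNIV_I linorder_neqE not_less_iff_gr_or_eq)

lemma strict_mono_right_inverse:
  fixes f :: "real \<Rightarrow> real"
  assumes "strict_mono f" "\<And>x. f (g x) = x"
  shows "strict_mono g"
  by (intro strict_monoI) (metis assms strict_mono_less)

lemma strict_mono_funpow: "strict_mono f \<Longrightarrow> strict_mono (f ^^ n)" for f :: "'a::order \<Rightarrow> 'a"
  by (induction n) (auto simp: strict_mono_def)

subsection \<open>Piecewise affine functions\<close>

text \<open>The derivative is locally constant, hence constant on the connected open interval;
  continuity extends the affine formula to both end points.\<close>

lemma locally_affine_on_interval: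
  assumes cont: "continuous_on {a..b} f" and aff: "\<And>x. a < x \<Longrightarrow> x < b \<Longrightarrow> locally_affine_at f x"
    and "a < b"
  obtains c d where "\<And>x. a \<le> x \<Longrightarrow> x \<le> b \<Longrightarrow> f x = c * x + d"
proof -
  have deriv: "(f has_real_derivative deriv f x) (at x)"
    and local: "\<exists>T. open T \<and> x \<in> T \<and> (\<forall>y\<in>T. deriv f y = deriv f x)" if x: "a < x" "x < b" for x
  proof -
    obtain c d T where T: "open T" "x \<in> T" "\<And>y. y \<in> T \<Longrightarrow> f y = c * y + d"
      using aff[OF x] unfolding locally_affine_at_def eventually_nhds by metis
    have der: "(f has_real_derivative c) (at y)" if "y \<in> T" for y
    proof (rule has_field_derivative_transform_within_open[OF _ T(1) that])
      show "((\<lambda>y. c * y + d) has_real_derivative c) (at y)"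
        by (auto intro!: derivative_eq_intros)
    qed (simp add: T(3))
    have "deriv f y = c" if "y \<in> T" for y
      using der[OF that] by (rule DERIV_imp_deriv)
    with der T(2) show "(f has_real_derivative deriv f x) (at x)" by simp
    show "\<exists>T. open T \<and> x \<in> T \<and> (\<forall>y\<in>T. deriv f y = deriv f x)"
      using T(1,2) \<open>\<And>y. y \<in> T \<Longrightarrow> deriv f y = c\<close> by (intro exI[of _ T]) simp
  qed
  have "deriv f constant_on {a<..<b}"
  proof (rule locally_constant_imp_constant)
    fix x assume x: "x \<in> {a<..<b}"
    then obtain T where T: "open T" "x \<in> T" "\<forall>y\<in>T. deriv f y = deriv f x"
      using local[of x] by (metis greaterThanLessThan_iff)
    show "\<exists>T. openin (top_of_set {a<..<b}) T \<and> x \<in> T \<and> (\<forall>y\<in>T. deriv f y = deriv f x)"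
    proof (intro exI conjI)
      show "openin (top_of_set {a<..<b}) ({a<..<b} \<inter> T)" by (rule openin_open_Int[OF T(1)])
      show "x \<in> {a<..<b} \<inter> T" using x T(2) by blast
      show "\<forall>y\<in>{a<..<b} \<inter> T. deriv f y = deriv f x" using T(3) by blast
    qed
  qed auto
  then obtain c where c: "deriv f x = c" if "a < x" "x < b" for x
    unfolding constant_on_def by auto
  have der0: "((\<lambda>x. f x - c * x) has_real_derivative 0) (at x)" if "a < x" "x < b" for x
    using deriv[OF that] c[OF that] by (auto intro!: derivative_eq_intros)
  have "f x - c * x = f a - c * a" if "a \<le> x" "x \<le> b" for x
  proof (rule DERIV_isconst2[OF \<open>a < b\<close> _ _ that])
    show "continuous_on {a..b} (\<lambda>x. f x - c * x)" by (intro continuous_intros cont)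
  qed (use der0 in auto)
  then show thesis by (intro that[of c "f a - c * a"]) (simp add: algebra_simps)
qed

text \<open>The filter is a parameter so that germs from the left, from the right and over a full
  neighbourhood \<open>nhds x\<close> share one notion.\<close>

definition affine_germ :: "(real \<Rightarrow> real) \<Rightarrow> real filter \<Rightarrow> bool" where
  "affine_germ f F \<longleftrightarrow> (\<exists>a b. \<forall>\<^sub>F y in F. f y = a * y + b)"

text \<open>The point \<open>x\<close> may be a break, but affine germs on both sides keep all other
  breaks away from it. This expresses discreteness of the breaks by a condition that can be verified
  one side at a time.\<close>

definition piecewise_affine :: "(real \<Rightarrow> real) \<Rightarrow> bool" where
  "piecewise_affine f \<longleftrightarrow> (\<forall>x. affine_germ f (at_left x) \<and> affine_germ f (at_right x))"

lemma affine_germ_cong: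
  assumes "\<forall>\<^sub>F y in F. f y = g y" "affine_germ g F"
  shows "affine_germ f F"
proof -
  obtain a b where "\<forall>\<^sub>F y in F. g y = a * y + b" using assms(2) by (auto simp: affine_germ_def)
  with assms(1) have "\<forall>\<^sub>F y in F. f y = a * y + b" by eventually_elim simp
  then show ?thesis by (auto simp: affine_germ_def)
qed

text \<open>A punctured neighbourhood without breaks gives an interval on each side of
  \<open>x\<close> on which \<open>f\<close> is affine; conversely, \<open>f\<close> is locally
  affine at every point inside two such intervals.\<close>

lemma PL_R_iff: "f \<in> carrier PL_R \<longleftrightarrow> f \<in> carrier homeo_R \<and> piecewise_affine f"
proof -
  have "(\<forall>x. \<forall>\<^sub>F y in at x. locally_affine_at f y) \<longleftrightarrow> piecewise_affine f"
    if "f \<in> carrier homeo_R"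
  proof
    assume loc: "\<forall>x. \<forall>\<^sub>F y in at x. locally_affine_at f y"
    have cont: "continuous_on A f" for A using homeo_group.continuous[OF homeo_group_homeo_R that] .
    have "affine_germ f (at_left x) \<and> affine_germ f (at_right x)" for x
    proof -
      have "\<forall>\<^sub>F y in at_left x. locally_affine_at f y" "\<forall>\<^sub>F y in at_right x. locally_affine_at f y"
        using loc by (auto simp: eventually_at_split)
      then obtain l r where l: "l < x" "\<And>y. l < y \<Longrightarrow> y < x \<Longrightarrow> locally_affine_at f y"
        and r: "x < r" "\<And>y. x < y \<Longrightarrow> y < r \<Longrightarrow> locally_affine_at f y"
        unfolding eventually_at_left_field eventually_at_right_field by metis
      obtain a b where ab: "\<And>y. l \<le> y \<Longrightarrow> y \<le> x \<Longrightarrow> f y = a * y + b"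
        using locally_affine_on_interval[OF cont l(2,1)] by blast
      obtain c d where cd: "\<And>y. x \<le> y \<Longrightarrow> y \<le> r \<Longrightarrow> f y = c * y + d"
        using locally_affine_on_interval[OF cont r(2,1)] by blast
      show ?thesis unfolding affine_germ_def eventually_at_left_field eventually_at_right_field
        using l(1) r(1) ab cd by (meson less_imp_le)
    qed
    then show "piecewise_affine f" by (simp add: piecewise_affine_def)
  next
    assume pa: "piecewise_affine f"
    show "\<forall>x. \<forall>\<^sub>F y in at x. locally_affine_at f y"
    proof
      fix x
      obtain a b c d where ab: "\<forall>\<^sub>F y in at_left x. f y = a * y + b"
        and cd: "\<forall>\<^sub>F y in at_right x. f y = c * y + d"
        using pa unfolding piecewise_affine_def affine_germ_def by metis
      obtain l r where l: "l < x" "\<And>y. l < y \<Longrightarrow> y < x \<Longrightarrow> f y = a * y + b"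
        and r: "x < r" "\<And>y. x < y \<Longrightarrow> y < r \<Longrightarrow> f y = c * y + d"
        using ab cd unfolding eventually_at_left_field eventually_at_right_field by metis
      have "locally_affine_at f y" if "l < y" "y < x" for y
        unfolding locally_affine_at_def eventually_nhds using l(2) that
        by (intro exI[of _ a] exI[of _ b] exI[of _ "{l<..<x}"]) auto
      moreover have "locally_affine_at f y" if "x < y" "y < r" for y
        unfolding locally_affine_at_def eventually_nhds using r(2) that
        by (intro exI[of _ c] exI[of _ d] exI[of _ "{x<..<r}"]) auto
      ultimately show "\<forall>\<^sub>F y in at x. locally_affine_at f y"
        unfolding eventually_at_split eventually_at_left_field eventually_at_right_field
        using l(1) r(1) by blast
    qed
  qed
  then show ?thesis by (auto simp: PL_R_def discrete_breaks_iff)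
qed

lemma piecewise_affine_affine [simp]: "piecewise_affine (\<lambda>x. c * x + d)"
  unfolding piecewise_affine_def affine_germ_def by (intro allI conjI exI[of _ c] exI[of _ d]) simp_all

section \<open>Maxima, minima and gluing of piecewise affine functions\<close>

lemma affine_sign_at_right:
  fixes a b :: real
  shows "(\<forall>\<^sub>F y in at_right x. 0 \<le> a * y + b) \<or> (\<forall>\<^sub>F y in at_right x. a * y + b \<le> 0)"
proof (cases "a * x + b" "0 :: real" rule: linorder_cases)
  case equal
  then have eq: "a * y + b = a * (y - x)" for y by (simp add: algebra_simps)
  have "\<forall>\<^sub>F y in at_right x. 0 < y - x"
    using eventually_at_right_less[of x] by eventually_elim simp
  then have "\<forall>\<^sub>F y in at_right x. 0 \<le> a * (y - x)" if "0 \<le> a"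
    by eventually_elim (use that in simp)
  moreover have "\<forall>\<^sub>F y in at_right x. a * (y - x) \<le> 0" if "a \<le> 0"
    using \<open>\<forall>\<^sub>F y in at_right x. 0 < y - x\<close>
    by eventually_elim (use that in \<open>simp add: mult_le_0_iff\<close>)
  ultimately show ?thesis unfolding eq by linarith
next
  case less
  have "((\<lambda>y. a * y + b) \<longlongrightarrow> a * x + b) (at_right x)" by (intro tendsto_intros)
  from order_tendstoD(2)[OF this less] have "\<forall>\<^sub>F y in at_right x. a * y + b \<le> 0"
    by eventually_elim simp
  then show ?thesis ..
next
  case greater
  have "((\<lambda>y. a * y + b) \<longlongrightarrow> a * x + b) (at_right x)" by (intro tendsto_intros)
  from order_tendstoD(1)[OF this greater] have "\<forall>\<^sub>F y in at_right x. 0 \<le> a * y + b"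
    by eventually_elim simp
  then show ?thesis ..
qed

lemma affine_sign_at_left:
  fixes a b :: real
  shows "(\<forall>\<^sub>F y in at_left x. 0 \<le> a * y + b) \<or> (\<forall>\<^sub>F y in at_left x. a * y + b \<le> 0)"
  using affine_sign_at_right[of "- a" b "- x"] by (simp add: at_left_minus eventually_filtermap)

text \<open>Where one of two affine functions dominates throughout, the maximum is one of them. The
  assumption \<open>sign\<close> is what one-sided filters provide; on \<open>nhds x\<close> it
  fails for an affine function that changes sign at \<open>x\<close>.\<close>

lemma affine_germ_max:
  assumes sign: "\<And>a b. (\<forall>\<^sub>F y in F. 0 \<le> a * y + b) \<or> (\<forall>\<^sub>F y in F. a * y + b \<le> 0)"
    and "affine_germ f F" "affine_germ g F"
  shows "affine_germ (\<lambda>x. max (f x) (g x)) F"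
proof -
  obtain a b c d where f: "\<forall>\<^sub>F y in F. f y = a * y + b" and g: "\<forall>\<^sub>F y in F. g y = c * y + d"
    using assms(2,3) by (auto simp: affine_germ_def)
  from sign[of "a - c" "b - d"] show ?thesis
  proof
    assume "\<forall>\<^sub>F y in F. 0 \<le> (a - c) * y + (b - d)"
    with f g have "\<forall>\<^sub>F y in F. max (f y) (g y) = f y"
      by eventually_elim (auto simp: algebra_simps)
    then show ?thesis using assms(2) by (rule affine_germ_cong)
  next
    assume "\<forall>\<^sub>F y in F. (a - c) * y + (b - d) \<le> 0"
    with f g have "\<forall>\<^sub>F y in F. max (f y) (g y) = g y"
      by eventually_elim (auto simp: algebra_simps)
    then show ?thesis using assms(3) by (rule affine_germ_cong)
  qed
qed

lemma affine_germ_linear: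
  assumes "affine_germ f F"
  shows "affine_germ (\<lambda>x. c * f x + d) F"
proof -
  obtain a b where "\<forall>\<^sub>F y in F. f y = a * y + b" using assms by (auto simp: affine_germ_def)
  then have "\<forall>\<^sub>F y in F. c * f y + d = (c * a) * y + (c * b + d)"
    by eventually_elim (simp add: algebra_simps)
  then show ?thesis unfolding affine_germ_def by blast
qed

lemma piecewise_affine_max:
  "piecewise_affine f \<Longrightarrow> piecewise_affine g \<Longrightarrow> piecewise_affine (\<lambda>x. max (f x) (g x))"
  by (simp add: piecewise_affine_def affine_germ_max affine_sign_at_left affine_sign_at_right)

lemma piecewise_affine_min:
  assumes "piecewise_affine f" "piecewise_affine g"
  shows "piecewise_affine (\<lambda>x. min (f x) (g x))"
proof -
  have neg: "piecewise_affine (\<lambda>x. - f x)" if "piecewise_affine f" for f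
    using that affine_germ_linear[of f _ "- 1" 0] by (simp add: piecewise_affine_def)
  have "(\<lambda>x. min (f x) (g x)) = (\<lambda>x. - max (- f x) (- g x))" by (auto simp: fun_eq_iff)
  then show ?thesis using assms by (simp add: neg piecewise_affine_max)
qed

lemma piecewise_affine_floor:
  assumes "\<And>n :: int. piecewise_affine (\<phi> n)"
  shows "piecewise_affine (\<lambda>x. \<phi> \<lfloor>x\<rfloor> x)"
proof -
  \<comment> \<open>The piece in force just to the left of \<open>x\<close> has index
    \<open>\<lceil>x\<rceil> - 1\<close>, also when \<open>x\<close> is an integer.\<close>
  have "affine_germ (\<lambda>x. \<phi> \<lfloor>x\<rfloor> x) (at_left x)" for x
  proof (rule affine_germ_cong)
    have "\<forall>\<^sub>F y in at_left x. y \<in> {of_int (\<lceil>x\<rceil> - 1)<..<x}"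
      by (intro eventually_at_leftI[of "of_int (\<lceil>x\<rceil> - 1)"]) linarith+
    then show "\<forall>\<^sub>F y in at_left x. \<phi> \<lfloor>y\<rfloor> y = \<phi> (\<lceil>x\<rceil> - 1) y"
    proof eventually_elim
      case (elim y)
      then have "\<lfloor>y\<rfloor> = \<lceil>x\<rceil> - 1" by (auto simp: floor_eq_iff) linarith
      then show ?case by simp
    qed
    show "affine_germ (\<phi> (\<lceil>x\<rceil> - 1)) (at_left x)" using assms by (simp add: piecewise_affine_def)
  qed
  moreover have "affine_germ (\<lambda>x. \<phi> \<lfloor>x\<rfloor> x) (at_right x)" for x
  proof (rule affine_germ_cong)
    have "\<forall>\<^sub>F y in at_right x. y \<in> {x<..<of_int (\<lfloor>x\<rfloor> + 1)}"
      by (intro eventually_at_rightI[of _ "of_int (\<lfloor>x\<rfloor> + 1)"]) linarith+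
    then show "\<forall>\<^sub>F y in at_right x. \<phi> \<lfloor>y\<rfloor> y = \<phi> \<lfloor>x\<rfloor> y"
    proof eventually_elim
      case (elim y)
      then have "\<lfloor>y\<rfloor> = \<lfloor>x\<rfloor>" by (auto simp: floor_eq_iff) linarith
      then show ?case by simp
    qed
    show "affine_germ (\<phi> \<lfloor>x\<rfloor>) (at_right x)" using assms by (simp add: piecewise_affine_def)
  qed
  ultimately show ?thesis by (simp add: piecewise_affine_def)
qed

lemma affine_mem_PL_R:
  assumes "c \<noteq> 0"
  shows "(\<lambda>x. c * x + d) \<in> carrier PL_R"
proof -
  have "homeomorphism UNIV UNIV (\<lambda>x. c * x + d) (\<lambda>x. (x - d) / c)"
    using assms by (auto intro!: homeomorphismI continuous_intros)
  then show ?thesis unfolding PL_R_iff by auto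
qed

text \<open>The minimum of the two inverses is a right inverse of the maximum, which is therefore an
  increasing surjection.\<close>

lemma max_mem_homeo_R:
  assumes "f \<in> carrier (orientation_preserving homeo_R)" "g \<in> carrier (orientation_preserving homeo_R)"
  shows "(\<lambda>x. max (f x) (g x)) \<in> carrier homeo_R"
proof -
  have mono: "strict_mono f" "strict_mono g" using assms by auto
  obtain f' g' where inv: "\<And>x. f (f' x) = x" "\<And>x. g (g' x) = x"
    using assms homeo_group.inverseE[OF homeo_group_homeo_R]
    by (metis carrier_orientation_preserving)
  have le: "f (min (f' y) (g' y)) \<le> y" "g (min (f' y) (g' y)) \<le> y" for y
    using strict_mono_leD[OF mono(1), of "min (f' y) (g' y)" "f' y"]
      strict_mono_leD[OF mono(2), of "min (f' y) (g' y)" "g' y"] by (auto simp: inv)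
  have "max (f (min (f' y) (g' y))) (g (min (f' y) (g' y))) = y" for y
    using le[of y] inv[of y] by (auto simp: min_def split: if_splits)
  moreover have "strict_mono (\<lambda>x. max (f x) (g x))"
  proof (rule strict_monoI)
    fix x y :: real assume "x < y"
    then have "f x < f y" "g x < g y" using mono by (auto dest: strict_monoD)
    then show "max (f x) (g x) < max (f y) (g y)" by linarith
  qed
  ultimately show ?thesis by (intro strict_mono_surj_homeo_R)
qed

subsection \<open>Reversible elements of PLF\<close>

text \<open>A single \<open>b\<close> lies strictly inside only finitely many windows from
  \<open>x n\<close> to \<open>x (n + k)\<close>, so a finite set spoils only finitely many
  \<open>n\<close>.\<close>

lemma exists_interval_avoiding_finite:
  fixes x :: "nat \<Rightarrow> real"
  assumes "finite B" "strict_mono x"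
  obtains n where "\<And>b. b \<in> B \<Longrightarrow> x n < b \<Longrightarrow> x (n + k) \<le> b"
proof -
  have "finite {n. x n < b \<and> b < x (n + k)}" for b
  proof (cases "\<exists>n. x n < b \<and> b < x (n + k)")
    case True
    then obtain n where n: "b < x (n + k)" by blast
    have "m < n + k" if "x m < b" for m
    proof -
      have "x m < x (n + k)" using n that by simp
      then show ?thesis using strict_mono_less[OF assms(2)] by simp
    qed
    then have "{n. x n < b \<and> b < x (n + k)} \<subseteq> {..<n + k}" by auto
    then show ?thesis using finite_subset by blast
  next
    case False
    then have "{n. x n < b \<and> b < x (n + k)} = {}" by blast
    then show ?thesis by (simp only: finite.emptyI)
  qed
  then have "finite (\<Union>b\<in>B. {n. x n < b \<and> b < x (n + k)})" using assms(1) by simp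
  then obtain n where "n \<notin> (\<Union>b\<in>B. {n. x n < b \<and> b < x (n + k)})"
    using ex_new_if_finite[OF infinite_UNIV_nat] by blast
  then show thesis using that[of n] by fastforce
qed

text \<open>The breaks of both maps are avoided at once, so the two affine formulas hold on the same
  window of \<open>k\<close> steps.\<close>

lemma PLF_R_affine_on_interval:
  fixes x :: "nat \<Rightarrow> real"
  assumes B: "finite {x. \<not> locally_affine_at f x}" "finite {x. \<not> locally_affine_at g x}"
    and cont: "continuous_on UNIV f" "continuous_on UNIV g"
    and x: "strict_mono x" and "0 < k"
  obtains n a b c d where "\<And>t. x n \<le> t \<Longrightarrow> t \<le> x (n + k) \<Longrightarrow> f t = a * t + b"
    "\<And>t. x n \<le> t \<Longrightarrow> t \<le> x (n + k) \<Longrightarrow> g t = c * t + d"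
proof -
  obtain n where n: "\<And>b. \<not> locally_affine_at f b \<or> \<not> locally_affine_at g b \<Longrightarrow> x n < b \<Longrightarrow> x (n + k) \<le> b"
    using exists_interval_avoiding_finite[OF finite_UnI[OF B] x] by auto
  have less: "x n < x (n + k)" using strict_monoD[OF x] \<open>0 < k\<close> by simp
  obtain a b where "\<And>t. x n \<le> t \<Longrightarrow> t \<le> x (n + k) \<Longrightarrow> f t = a * t + b"
    using locally_affine_on_interval[OF continuous_on_subset[OF cont(1)] _ less] n by (metis not_le top_greatest)
  moreover obtain c d where "\<And>t. x n \<le> t \<Longrightarrow> t \<le> x (n + k) \<Longrightarrow> g t = c * t + d"
    using locally_affine_on_interval[OF continuous_on_subset[OF cont(2)] _ less] n by (metis not_le top_greatest)
  ultimately show thesis using that by blast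
qed

section \<open>Uniqueness of increasing square roots in PLF\<close>

lemma strict_mono_orbit:
  fixes f :: "'a::order \<Rightarrow> 'a"
  assumes "strict_mono f" "q < f q"
  shows "strict_mono (\<lambda>n. (f ^^ n) q)"
proof (rule strict_monoI_Suc)
  show "(f ^^ n) q < (f ^^ Suc n) q" for n
    using strict_monoD[OF strict_mono_funpow[OF assms(1), of n] assms(2)] by (simp add: funpow_swap1)
qed

lemma funpow_commute: "(\<And>x. f (g x) = g (f x)) \<Longrightarrow> f ((g ^^ n) x) = (g ^^ n) (f x)"
  by (induction n) auto

interpretation PLF: homeo_group PLF_R by (rule homeo_group_PLF_R)

lemma PLF_R_finite: "f \<in> carrier PLF_R \<Longrightarrow> finite {x. \<not> locally_affine_at f x}"
  by (simp add: PLF_R_def)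

text \<open>Both roots commute with their common square \<open>w\<close>, so it suffices to compare
  them at a point \<open>s\<close> of the \<open>w\<close>-orbit of \<open>q\<close>. This point is
  chosen where both roots are affine, and there the coefficients of the square determine those of an
  increasing root.\<close>

lemma PLF_R_square_root_unique_aux:
  assumes f: "f \<in> carrier PLF_R" "strict_mono f" and g: "g \<in> carrier PLF_R" "strict_mono g"
    and eq: "\<And>x. f (f x) = g (g x)" and q: "q < g q"
  shows "f q = g q"
proof -
  define w where "w = (\<lambda>x. g (g x))"
  have w: "strict_mono w" using g(2) by (simp add: w_def strict_mono_def)
  have fw: "f (w x) = w (f x)" for x by (simp add: w_def flip: eq)
  have gw: "g (w x) = w (g x)" for x by (simp add: w_def)
  have ww: "f (f x) = w x" "g (g x) = w x" for x by (simp_all add: w_def eq)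
  have "g q < w q" using strict_monoD[OF g(2) q] by (simp add: w_def)
  with q have qw: "q < w q" by simp
  have qf: "q < f q"
  proof (rule ccontr)
    assume "\<not> q < f q"
    then have "f (f q) \<le> f q" using strict_mono_leD[OF f(2)] by simp
    with qw \<open>\<not> q < f q\<close> show False by (simp add: ww)
  qed
  \<comment> \<open>Two steps of \<open>w\<close> are requested because \<open>f\<close> and
    \<open>g\<close> carry the first step, from \<open>s\<close> to \<open>w s\<close>, into the
    range from \<open>s\<close> to \<open>w (w s)\<close>; the same formula then applies to both
    factors of the square.\<close>
  obtain n a b c d
    where fa: "\<And>t. (w ^^ n) q \<le> t \<Longrightarrow> t \<le> (w ^^ (n + 2)) q \<Longrightarrow> f t = a * t + b"
      and ga: "\<And>t. (w ^^ n) q \<le> t \<Longrightarrow> t \<le> (w ^^ (n + 2)) q \<Longrightarrow> g t = c * t + d"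
    by (rule PLF_R_affine_on_interval[OF PLF_R_finite[OF f(1)] PLF_R_finite[OF g(1)]
          PLF.continuous[OF f(1)] PLF.continuous[OF g(1)] strict_mono_orbit[OF w qw] zero_less_numeral[of "num.Bit0 num.One"]]) (rule that, blast+)
  define s where "s = (w ^^ n) q"
  have s: "s < f s" "s < g s" "s < w s"
    using strict_monoD[OF strict_mono_funpow[OF w, of n]] qf q qw
      funpow_commute[of f w, OF fw] funpow_commute[of g w, OF gw] funpow_commute[of w w]
    by (simp_all add: s_def)
  have sw: "(w ^^ (n + 2)) q = w (w s)" by (simp add: s_def)
  have fs: "f s < w s" "g s < w s"
    using strict_monoD[OF f(2) s(1)] strict_monoD[OF g(2) s(2)] by (simp_all add: ww)
  have step: "f t = a * t + b \<and> f (f t) = a * (a * t + b) + b \<and> g t = c * t + d \<and> g (g t) = c * (c * t + d) + d"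
    if "s \<le> t" "t \<le> w s" for t
  proof -
    have 1: "t \<le> w (w s)" using that(2) s(3) strict_mono_leD[OF w, of s "w s"] by simp
    have 2: "s \<le> f t" "s \<le> g t"
      using strict_mono_leD[OF f(2) that(1)] strict_mono_leD[OF g(2) that(1)] s by auto
    have 3: "f t \<le> w (w s)" "g t \<le> w (w s)"
      using strict_mono_leD[OF f(2) that(2)] strict_mono_leD[OF g(2) that(2)]
        strict_monoD[OF w fs(1)] strict_monoD[OF w fs(2)] by (auto simp: fw gw)
    have "f t = a * t + b" "g t = c * t + d" using fa[of t] ga[of t] that 1 by (auto simp: sw s_def)
    moreover have "f (f t) = a * f t + b" "g (g t) = c * g t + d"
      using fa[of "f t"] ga[of "g t"] 2 3 unfolding sw s_def by blast+
    ultimately show ?thesis by simp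
  qed
  have S: "f s = a * s + b" "f (f s) = a * (a * s + b) + b" "g s = c * s + d" "g (g s) = c * (c * s + d) + d"
    using step[of s] s by auto
  have W: "f (w s) = a * w s + b" "f (f (w s)) = a * (a * w s + b) + b"
     "g (w s) = c * w s + d" "g (g (w s)) = c * (c * w s + d) + d"
    using step[of "w s"] s by auto
  have "a * (w s - s) > 0" "c * (w s - s) > 0"
    using strict_monoD[OF f(2) s(3)] strict_monoD[OF g(2) s(3)] S W by (auto simp: algebra_simps)
  then have pos: "a > 0" "c > 0" using s by (auto simp: zero_less_mult_iff)
  \<comment> \<open>Between \<open>s\<close> and \<open>w s\<close> the square has slope
    \<open>a\<^sup>2\<close> by way of \<open>f\<close> and \<open>c\<^sup>2\<close> by way of
    \<open>g\<close>. Positivity gives \<open>a = c\<close>, and comparing the constant terms then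
    gives \<open>b = d\<close>.\<close>
  have "(a\<^sup>2 - c\<^sup>2) * (w s - s) = 0"
    using S(2,4) W(2,4) eq[of s] eq[of "w s"] by (simp add: algebra_simps power2_eq_square)
  then have "a\<^sup>2 = c\<^sup>2" using s by simp
  then have ac: "a = c" using pos power2_eq_imp_eq by fastforce
  have "(a + 1) * (b - d) = 0"
    using S(2,4) eq[of s] by (simp add: ac algebra_simps)
  then have "b = d" using pos by auto
  with ac have "f s = g s" using S by simp
  then have "(w ^^ n) (f q) = (w ^^ n) (g q)"
    using funpow_commute[of f w, OF fw] funpow_commute[of g w, OF gw] by (simp add: s_def)
  then show ?thesis using strict_mono_eq[OF strict_mono_funpow[OF w]] by blast
qed

text \<open>A fixed point \<open>q\<close> of \<open>g\<close> satisfies \<open>f (f q) = q\<close>,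
  which forces the increasing map \<open>f\<close> to fix it. If \<open>g\<close> moves
  \<open>q\<close> down, the inverses are compared at \<open>g q\<close>, which the inverse of
  \<open>g\<close> moves up.\<close>

lemma PLF_R_square_root_unique:
  assumes f: "f \<in> carrier PLF_R" "strict_mono f" and g: "g \<in> carrier PLF_R" "strict_mono g"
    and eq: "\<And>x. f (f x) = g (g x)"
  shows "f q = g q"
proof (cases q "g q" rule: linorder_cases)
  case less
  then show ?thesis using PLF_R_square_root_unique_aux[OF f g eq] by simp
next
  case equal
  then have "f (f q) = q" using eq[of q] by simp
  then show ?thesis
    using equal strict_monoD[OF f(2), of q "f q"] strict_monoD[OF f(2), of "f q" q]
    by (cases q "f q" rule: linorder_cases) auto
next
  case greater
  obtain f' where f': "f' \<in> carrier PLF_R" "\<And>x. f' (f x) = x" "\<And>x. f (f' x) = x"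
    using PLF.inverseE[OF f(1)] by blast
  obtain g' where g': "g' \<in> carrier PLF_R" "\<And>x. g' (g x) = x" "\<And>x. g (g' x) = x"
    using PLF.inverseE[OF g(1)] by blast
  have mono: "strict_mono f'" "strict_mono g'"
    by (rule strict_mono_right_inverse[OF f(2) f'(3)], rule strict_mono_right_inverse[OF g(2) g'(3)])
  have eq': "f' (f' x) = g' (g' x)" for x
    using eq[of "f' (f' x)"] f' g' by metis
  have "f' (g q) = g' (g q)"
    by (rule PLF_R_square_root_unique_aux[OF f'(1) mono(1) g'(1) mono(2) eq']) (simp add: g' greater)
  then show ?thesis using f' g' by metis
qed

lemma PLF_R_reversed_by_strict_mono:
  assumes f: "f \<in> carrier PLF_R" "strict_mono f" and h: "h \<in> carrier PLF_R" "strict_mono h"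
    and rev: "\<And>x. f (h (f x)) = h x"
  shows "f = id"
proof
  fix x
  obtain y where y: "h y = x" using PLF.inverseE[OF h(1)] by metis
  have "(f \<circ> h) y = h y"
  proof (rule PLF_R_square_root_unique[of "f \<circ> h"])
    show "f \<circ> h \<in> carrier PLF_R" by (rule PLF.comp_closed[OF f(1) h(1)])
    show "strict_mono (f \<circ> h)" using f(2) h(2) by (simp add: strict_mono_def)
  qed (use h rev in auto)
  with y show "f x = id x" by simp
qed

lemma reversible_PLF_R_strict_mono:
  "reversible (orientation_preserving PLF_R) f \<longleftrightarrow> f = id"
proof -
  interpret P: homeo_group "orientation_preserving PLF_R"
    by (rule homeo_group_orientation_preserving[OF homeo_group_PLF_R])
  show ?thesis
  proof
    assume "reversible (orientation_preserving PLF_R) f"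
    then show "f = id"
      by (elim P.reversibleE) (auto intro: PLF_R_reversed_by_strict_mono)
  next
    assume "f = id"
    then show "reversible (orientation_preserving PLF_R) f"
      using P.id_closed by (auto intro: P.reversibleI[of _ id])
  qed
qed

text \<open>The orbit of \<open>q\<close> under \<open>f\<close> is fixed by \<open>w\<close>, and \<open>w\<close> is affine between some two consecutive orbit points.\<close>

lemma PLF_R_commuting_fix:
  assumes w: "w \<in> carrier PLF_R" and f: "strict_mono f" and comm: "\<And>x. w (f x) = f (w x)"
    and fix_q: "w q = q" and q: "q < f q" "q \<le> y" "y \<le> f q"
  shows "w y = y"
proof -
  obtain n a b
    where wa: "\<And>t. (f ^^ n) q \<le> t \<Longrightarrow> t \<le> (f ^^ (n + 1)) q \<Longrightarrow> w t = a * t + b"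
    by (rule PLF_R_affine_on_interval[OF PLF_R_finite[OF w] PLF_R_finite[OF w]
          PLF.continuous[OF w] PLF.continuous[OF w] strict_mono_orbit[OF f q(1)] zero_less_one]) (rule that, blast+)
  have wf: "w ((f ^^ m) x) = (f ^^ m) (w x)" for m x
    by (rule funpow_commute) (rule comm)
  define s where "s = (f ^^ n) q"
  have s1: "(f ^^ (n + 1)) q = f s" by (simp add: s_def)
  have s: "s < f s" "w s = s" "w (f s) = f s"
    using strict_mono_orbit[OF f q(1), THEN strict_monoD, of n "Suc n"] by (simp_all add: s_def wf comm fix_q)
  \<comment> \<open>An affine map fixing both \<open>s\<close> and \<open>f s\<close> is the
    identity. The point \<open>y\<close> is carried between them by the \<open>n\<close>th power of
    \<open>f\<close>, which commutes with \<open>w\<close>.\<close>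
  have "(a - 1) * (f s - s) = (a * f s + b) - (a * s + b) - (f s - s)"
    by (simp add: algebra_simps)
  also have "\<dots> = 0"
    using wa[of s] wa[of "f s"] s by (simp add: s1 flip: s_def)
  finally have "(a - 1) * (f s - s) = 0" .
  then have a: "a = 1" using s by simp
  have b: "b = 0" using wa[of s] s by (simp add: s1 a flip: s_def)
  have "s \<le> (f ^^ n) y" "(f ^^ n) y \<le> f s"
    using strict_mono_leD[OF strict_mono_funpow[OF f, of n] q(2)]
      strict_mono_leD[OF strict_mono_funpow[OF f, of n] q(3)] by (simp_all add: s_def funpow_swap1)
  then have "w ((f ^^ n) y) = (f ^^ n) y"
    using wa by (simp add: s1 a b flip: s_def)
  then show ?thesis using strict_mono_eq[OF strict_mono_funpow[OF f]] by (simp add: wf)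
qed

text \<open>An involutory reverser \<open>s\<close> writes \<open>f\<close> as the product of the
  involutions \<open>s\<close> and \<open>s \<circ> f\<close>. It is glued from \<open>h\<close> and
  its inverse, both of which reverse \<open>f\<close>, so only points that \<open>f\<close> carries
  across the gluing point need an argument.\<close>

lemma PLF_R_reversed_by_antimono:
  assumes f: "f \<in> carrier PLF_R" "strict_mono f" and h: "h \<in> carrier PLF_R" "strict_antimono_on UNIV h"
    and rev: "\<And>x. f (h (f x)) = h x"
  obtains s where "s \<in> carrier PLF_R" "\<And>x. s (s x) = x" "\<And>x. f (s (f x)) = s x"
proof -
  obtain f' where f': "f' \<in> carrier PLF_R" "\<And>x. f' (f x) = x" "\<And>x. f (f' x) = x"
    using PLF.inverseE[OF f(1)] by blast
  obtain h' where h': "h' \<in> carrier PLF_R" "\<And>x. h' (h x) = x" "\<And>x. h (h' x) = x"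
    using PLF.inverseE[OF h(1)] by blast
  have mono': "strict_mono f'" by (rule strict_mono_right_inverse[OF f(2) f'(3)])
  have anti: "h x < h y \<longleftrightarrow> y < x" for x y by (rule strict_antimono_less[OF h(2)])
  have anti': "h' x < h' y \<longleftrightarrow> y < x" for x y
    by (metis anti h'(3))
  have cont: "continuous_on A h" "continuous_on A h'" for A
    using PLF.continuous h(1) h'(1) by blast+
  have rev': "f (h' (f x)) = h' x" for x
    by (metis rev h' f')
  \<comment> \<open>For decreasing \<open>h\<close>, the difference \<open>q - h q\<close> changes
    sign between \<open>0\<close> and \<open>h 0\<close>.\<close>
  have "\<exists>q. h q = q"
  proof -
    have "\<exists>q. min 0 (h 0) \<le> q \<and> q \<le> max 0 (h 0) \<and> q - h q = 0"
      using anti[of 0 "h 0"] anti[of "h 0" 0]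
      by (intro IVT') (auto simp: min_def max_def intro!: continuous_intros cont)
    then show ?thesis by (metis eq_iff_diff_eq_0)
  qed
  then obtain q where q: "h q = q" by blast
  have q': "h' q = q" using h'(2)[of q] q by simp
  define s where "s = (\<lambda>x. if q \<le> x then h x else h' x)"
  have hle: "h x \<le> q \<longleftrightarrow> q \<le> x" "h' x \<le> q \<longleftrightarrow> q \<le> x" "q \<le> h x \<longleftrightarrow> x \<le> q" "q \<le> h' x \<longleftrightarrow> x \<le> q" for x
    using anti[of q x] anti'[of q x] anti[of x q] anti'[of x q] q q' by (auto simp: not_less[symmetric])
  have ss: "s (s x) = x" for x
    using h'(2,3) hle[of x] q q' by (auto simp: s_def)
  have "continuous_on UNIV s"
  proof -
    have "continuous_on ({q..} \<union> {..q}) s" unfolding s_def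
      by (rule continuous_on_cases) (use q q' cont in auto)
    then show ?thesis by (metis UNIV_eq_I UnI1 UnI2 atLeast_iff atMost_iff linear)
  qed
  then have "homeomorphism UNIV UNIV s s" using ss by (auto simp: homeomorphism_def intro!: surjI)
  moreover have "{x. \<not> locally_affine_at s x} \<subseteq>
      insert q ({x. \<not> locally_affine_at h x} \<union> {x. \<not> locally_affine_at h' x})"
  proof -
    have "locally_affine_at s x" if "x \<noteq> q" "locally_affine_at h x" "locally_affine_at h' x" for x
    proof (cases "q < x")
      case True
      then have "\<forall>\<^sub>F y in nhds x. q < y" by (metis eventually_nhds greaterThan_iff open_greaterThan)
      then have "\<forall>\<^sub>F y in nhds x. s y = h y" by eventually_elim (simp add: s_def)
      with that(2) show ?thesis using affine_germ_cong[of s h "nhds x"]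
        by (simp add: affine_germ_def locally_affine_at_def)
    next
      case False
      then have "x < q" using that by simp
      then have "\<forall>\<^sub>F y in nhds x. y < q" by (metis eventually_nhds lessThan_iff open_lessThan)
      then have "\<forall>\<^sub>F y in nhds x. s y = h' y" by eventually_elim (simp add: s_def)
      with that(3) show ?thesis using affine_germ_cong[of s h' "nhds x"]
        by (simp add: affine_germ_def locally_affine_at_def)
    qed
    then show ?thesis by auto
  qed
  then have "finite {x. \<not> locally_affine_at s x}"
    by (rule finite_subset) (use PLF_R_finite h(1) h'(1) in auto)
  ultimately have "s \<in> carrier PLF_R" by (auto simp: PLF_R_def)
  moreover have "f (s (f x)) = s x" for x
  proof -
    \<comment> \<open>If \<open>x\<close> and \<open>f x\<close> lie on the same side of
      \<open>q\<close>, a single branch of \<open>s\<close> is involved. Otherwise \<open>w\<close>,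
      which fixes \<open>q\<close> and commutes with \<open>f\<close> and \<open>f'\<close>, is the
      identity between \<open>q\<close> and its image under \<open>f\<close> or \<open>f'\<close>;
      this makes \<open>h\<close> and \<open>h'\<close> agree at \<open>x\<close>.\<close>
    define w where "w = h \<circ> h"
    have w: "w \<in> carrier PLF_R" unfolding w_def using PLF.comp_closed h(1) by blast
    have wf: "w (f x) = f (w x)" for x unfolding w_def comp_def by (metis rev f'(3))
    have wf': "w (f' x) = f' (w x)" for x by (metis wf f'(2,3))
    have wq: "w q = q" by (simp add: w_def q)
    consider "q \<le> x" "q \<le> f x" | "x < q" "f x < q" | "x < q" "q \<le> f x" | "q \<le> x" "f x < q" by linarith
    then show ?thesis
    proof cases
      case 3
      have "q < f q" using strict_monoD[OF f(2) 3(1)] 3(2) by simp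
      then have "w (f x) = f x"
        by (rule PLF_R_commuting_fix[OF w f(2) wf wq]) (use 3 strict_monoD[OF f(2), of x q] in auto)
      then have "h (h x) = x" by (metis wf f'(2) w_def comp_apply)
      then have "h x = h' x" by (metis h'(2))
      with 3 show ?thesis by (simp add: s_def rev)
    next
      case 4
      have "x < f' q" using strict_monoD[OF mono' 4(2)] by (simp add: f')
      then have "w x = x"
        by (intro PLF_R_commuting_fix[OF w mono' wf' wq]) (use 4 in auto)
      then have "h x = h' x" by (metis h'(2) w_def comp_apply)
      with 4 show ?thesis by (simp add: s_def rev')
    qed (simp_all add: s_def rev rev')
  qed
  ultimately show thesis using that ss by blast
qed

text \<open>For decreasing \<open>f\<close>, the square \<open>f \<circ> f\<close> is increasing and
  is reversed by both \<open>h\<close> and \<open>f \<circ> h\<close>, one of which is increasing.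
  Hence the square is the identity and \<open>f\<close> is already an involution.\<close>

lemma reversible_PLF_R_imp_involutions:
  assumes "reversible PLF_R f"
  shows "\<exists>s t. involution PLF_R s \<and> involution PLF_R t \<and> f = s \<otimes>\<^bsub>PLF_R\<^esub> t"
proof -
  obtain h where f: "f \<in> carrier PLF_R" and h: "h \<in> carrier PLF_R" and rev: "\<And>x. f (h (f x)) = h x"
    using PLF.reversibleE[OF assms] by blast
  have id: "id \<in> carrier PLF_R" by (rule PLF.id_closed)
  have cases: "strict_mono g \<or> strict_antimono_on UNIV g" if "g \<in> carrier PLF_R" for g
    using that by (intro strict_mono_or_antimono) (simp add: PLF_R_def)
  show ?thesis
  proof (cases "strict_mono f")
    case True
    from cases[OF h] show ?thesis
    proof
      assume "strict_mono h"
      with f h rev True have "f = id" by (intro PLF_R_reversed_by_strict_mono)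
      then show ?thesis
        using id by (intro exI[of _ id]) (auto simp: involution_def)
    next
      assume "strict_antimono_on UNIV h"
      then obtain s where s: "s \<in> carrier PLF_R" "\<And>x. s (s x) = x" "\<And>x. f (s (f x)) = s x"
        using PLF_R_reversed_by_antimono[OF f True h _ rev] by blast
      have "involution PLF_R s" using s by (auto simp: involution_def)
      moreover have "involution PLF_R (s \<circ> f)"
        using s PLF.comp_closed[OF s(1) f] by (auto simp: involution_def fun_eq_iff)
      moreover have "f = s \<circ> (s \<circ> f)" using s by (auto simp: fun_eq_iff)
      ultimately show ?thesis by (metis PLF.mult_eq)
    qed
  next
    case False
    then have anti: "strict_antimono_on UNIV f" using cases[OF f] by blast
    have ff: "f \<circ> f \<in> carrier PLF_R" "strict_mono (f \<circ> f)"
      using PLF.comp_closed[OF f f] anti by (auto simp: monotone_on_def)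
    have "f \<circ> f = id"
      using cases[OF h]
    proof
      assume "strict_mono h"
      then show ?thesis by (intro PLF_R_reversed_by_strict_mono[OF ff h]) (auto simp: rev)
    next
      assume "strict_antimono_on UNIV h"
      then have "strict_mono (f \<circ> h)" using anti by (auto simp: monotone_on_def)
      then show ?thesis
        by (intro PLF_R_reversed_by_strict_mono[OF ff PLF.comp_closed[OF f h]]) (auto simp: rev)
    qed
    then have "involution PLF_R f" using f by (simp add: involution_def)
    then show ?thesis
      using id by (intro exI[of _ f] exI[of _ id]) (simp add: involution_def)
  qed
qed

subsection \<open>Conjugation to a translation\<close>

interpretation Homeo: homeo_group homeo_R by (rule homeo_group_homeo_R)
interpretation Homeo_plus: homeo_group "orientation_preserving homeo_R"
  by (rule homeo_group_orientation_preserving[OF homeo_group_homeo_R])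
interpretation PL: homeo_group PL_R by (rule homeo_group_PL_R)
interpretation PL_plus: homeo_group "orientation_preserving PL_R"
  by (rule homeo_group_orientation_preserving[OF homeo_group_PL_R])

text \<open>Each piece increases on the whole line, so it suffices to pass through the integers
  between the two arguments, where neighbouring pieces agree.\<close>

lemma strict_mono_floor_glue:
  fixes \<phi> :: "int \<Rightarrow> real \<Rightarrow> real"
  assumes mono: "\<And>n. strict_mono (\<phi> n)"
    and glue: "\<And>n. \<phi> n (of_int (n + 1)) = \<phi> (n + 1) (of_int (n + 1))"
  shows "strict_mono (\<lambda>x. \<phi> \<lfloor>x\<rfloor> x)"
proof (rule strict_monoI)
  have step: "\<phi> n (of_int n) \<le> \<phi> m (of_int m)" if "n \<le> m" for n m
    using that
  proof (induction m rule: int_ge_induct)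
    case (step m)
    have "\<phi> m (of_int m) < \<phi> m (of_int (m + 1))" by (rule strict_monoD[OF mono]) simp
    with step glue[of m] show ?case by simp
  qed simp
  fix x y :: real assume "x < y"
  show "\<phi> \<lfloor>x\<rfloor> x < \<phi> \<lfloor>y\<rfloor> y"
  proof (cases "\<lfloor>x\<rfloor> = \<lfloor>y\<rfloor>")
    case True
    then show ?thesis using strict_monoD[OF mono \<open>x < y\<close>] by simp
  next
    case False
    then have *: "\<lfloor>x\<rfloor> + 1 \<le> \<lfloor>y\<rfloor>" using floor_mono[of x y] \<open>x < y\<close> by simp
    have "\<phi> \<lfloor>x\<rfloor> x < \<phi> \<lfloor>x\<rfloor> (of_int (\<lfloor>x\<rfloor> + 1))" by (rule strict_monoD[OF mono]) linarith
    also have "\<dots> = \<phi> (\<lfloor>x\<rfloor> + 1) (of_int (\<lfloor>x\<rfloor> + 1))" by (rule glue)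
    also have "\<dots> \<le> \<phi> \<lfloor>y\<rfloor> (of_int \<lfloor>y\<rfloor>)" by (rule step[OF *])
    also have "\<dots> \<le> \<phi> \<lfloor>y\<rfloor> y" by (rule strict_mono_leD[OF mono]) simp
    finally show ?thesis .
  qed
qed

text \<open>The bounded increasing orbit converges, and by continuity its limit is fixed.\<close>

lemma orbit_bounded_imp_fixpoint:
  fixes f :: "real \<Rightarrow> real"
  assumes f: "strict_mono f" and cont: "continuous_on UNIV f" and p: "p < f p"
    and bound: "\<And>n :: nat. (f ^^ n) p \<le> y"
  shows "\<exists>z. p \<le> z \<and> z \<le> y \<and> f z = z"
proof -
  have "(f ^^ n) p \<le> (f ^^ Suc n) p" for n
    using strict_mono_leD[OF strict_mono_funpow[OF f, of n], of p "f p"] p by (simp add: funpow_swap1)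
  then have inc: "incseq (\<lambda>n. (f ^^ n) p)" by (rule incseq_SucI)
  obtain L where L: "(\<lambda>n. (f ^^ n) p) \<longlonglongrightarrow> L" "\<forall>n. (f ^^ n) p \<le> L"
    using incseq_convergent[OF inc] bound by blast
  have "(\<lambda>n. f ((f ^^ n) p)) \<longlonglongrightarrow> f L"
    using cont L(1) by (auto intro: continuous_on_tendsto_compose)
  moreover have "(\<lambda>n. f ((f ^^ n) p)) \<longlonglongrightarrow> L"
    using LIMSEQ_Suc[OF L(1)] by simp
  ultimately have "f L = L" by (rule LIMSEQ_unique)
  moreover have "p \<le> L" using L(2)[rule_format, of 0] by simp
  moreover have "L \<le> y" using LIMSEQ_le_const2[OF L(1)] bound by blast
  ultimately show ?thesis by blast
qed

text \<open>The map \<open>k\<close> takes \<open>[n, n + 1)\<close> affinely onto \<open>[p, f p)\<close> and then applies the \<open>n\<close>th power of \<open>f\<close>.\<close>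

lemma (in homeo_group) ex_translation_conjugacy:
  assumes G: "f \<in> carrier G" and f: "strict_mono f" and p: "p < f p"
  shows "\<exists>k. strict_mono k \<and> (\<forall>x. k (x + 1) = f (k x)) \<and>
    range k = {y. \<forall>z\<in>closed_segment p y. f z \<noteq> z} \<and> (G = PL_R \<longrightarrow> piecewise_affine k)"
proof -
  interpret P: homeo_group "orientation_preserving G"
    using homeo_group_orientation_preserving homeo_group_axioms .
  \<comment> \<open>Integer powers are taken in the increasing subgroup, so each is an increasing
    element of \<open>G\<close> and additivity in the exponent covers negative powers.\<close>
  define F where "F n = f [^]\<^bsub>orientation_preserving G\<^esub> n" for n :: int
  have fP: "f \<in> carrier (orientation_preserving G)" using G f by simp
  have F: "F n \<in> carrier G" "strict_mono (F n)" for n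
    using P.int_pow_closed[OF fP, of n] by (simp_all add: F_def)
  have F_add: "F (m + n) x = F m (F n x)" for m n x
    using P.int_pow_mult[OF fP, of m n] by (simp add: F_def)
  have F_01: "F 0 x = x" "F 1 x = f x" for x using fP by (simp_all add: F_def)
  have F_cancel: "F n (F (- n) x) = x" "F (- n) (F n x) = x" for n x
    using F_add[of n "- n" x] F_add[of "- n" n x] by (simp_all add: F_01)
  have F_nat: "F (int n) x = (f ^^ n) x" for n x
    by (induction n) (simp_all add: F_add F_01)
  have F_commute: "F n (f x) = f (F n x)" for n x
    using F_add[of n 1 x] F_add[of 1 n x] by (simp add: F_01 add.commute)
  have F_fix: "F n z = z" if "f z = z" for n z
  proof -
    have nat: "F (int m) z = z" for m
      using that by (induction m) (simp_all add: F_add F_01)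
    show ?thesis
    proof (cases "n \<ge> 0")
      case True
      then show ?thesis using nat[of "nat n"] by simp
    next
      case False
      then show ?thesis using nat[of "nat (- n)"] F_cancel(1)[of n z] by simp
    qed
  qed
  define \<phi> where "\<phi> n x = F n ((f p - p) * x + (p - (f p - p) * of_int n))" for n x
  define k where "k x = \<phi> \<lfloor>x\<rfloor> x" for x
  have mono\<phi>: "strict_mono (\<phi> n)" for n
    unfolding \<phi>_def using p by (intro strict_monoI strict_monoD[OF F(2)]) simp
  \<comment> \<open>The right end \<open>f p\<close> of the fundamental domain under the
    \<open>n\<close>th power is its left end \<open>p\<close> under the next power.\<close>
  have glue: "\<phi> n (of_int (n + 1)) = \<phi> (n + 1) (of_int (n + 1))" for n
  proof -
    have "\<phi> n (of_int (n + 1)) = F n (f p)" by (simp add: \<phi>_def algebra_simps)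
    also have "\<dots> = F (n + 1) p" by (simp add: F_add F_01)
    also have "\<dots> = \<phi> (n + 1) (of_int (n + 1))" by (simp add: \<phi>_def)
    finally show ?thesis .
  qed
  have mono: "strict_mono k"
    using strict_mono_floor_glue[OF mono\<phi> glue] by (simp add: k_def[abs_def])
  have shift: "k (x + 1) = f (k x)" for x
  proof -
    have "k (x + 1) = F (\<lfloor>x\<rfloor> + 1) ((f p - p) * x + (p - (f p - p) * of_int \<lfloor>x\<rfloor>))"
      by (simp add: k_def \<phi>_def algebra_simps)
    also have "\<dots> = f (k x)" by (simp add: F_add F_01 F_commute k_def \<phi>_def)
    finally show ?thesis .
  qed
  have k_int: "k (of_int n) = F n p" for n by (simp add: k_def \<phi>_def)
  \<comment> \<open>The image is the component of \<open>p\<close> in the set of moved points: a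
    fixed point between \<open>p\<close> and \<open>y\<close> bounds the whole orbit of
    \<open>p\<close>, while without one the orbit passes \<open>y\<close> in both
    directions.\<close>
  have "range k = {y. \<forall>z\<in>closed_segment p y. f z \<noteq> z}"
  proof (intro equalityI subsetI)
    fix y assume "y \<in> range k"
    then obtain x where x: "y = k x" by blast
    have "f z \<noteq> z" if z: "z \<in> closed_segment p y" for z
    proof
      assume fz: "f z = z"
      have "p \<noteq> z" using p fz by auto
      then consider "p < z" | "z < p" by linarith
      then show False
      proof cases
        case 1
        then have "z \<le> k x" using z x by (auto simp: closed_segment_eq_real_ivl split: if_splits)
        also have "k x < k (of_int (\<lfloor>x\<rfloor> + 1))" by (rule strict_monoD[OF mono]) linarith
        also have "\<dots> < F (\<lfloor>x\<rfloor> + 1) z" unfolding k_int by (rule strict_monoD[OF F(2) 1])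
        finally show False by (simp add: F_fix[OF fz])
      next
        case 2
        have "F \<lfloor>x\<rfloor> z < k (of_int \<lfloor>x\<rfloor>)" unfolding k_int by (rule strict_monoD[OF F(2) 2])
        also have "\<dots> \<le> k x" by (rule strict_mono_leD[OF mono]) simp
        also have "k x \<le> z" using 2 z x by (auto simp: closed_segment_eq_real_ivl split: if_splits)
        finally show False by (simp add: F_fix[OF fz])
      qed
    qed
    then show "y \<in> {y. \<forall>z\<in>closed_segment p y. f z \<noteq> z}" by blast
  next
    fix y assume "y \<in> {y. \<forall>z\<in>closed_segment p y. f z \<noteq> z}"
    then have y: "f z \<noteq> z" if "z \<in> closed_segment p y" for z using that by blast
    have up: "\<exists>n. y < F n p"
    proof (rule ccontr)
      assume "\<not> ?thesis"
      then have "(f ^^ n) p \<le> y" for n by (simp add: not_less flip: F_nat)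
      then obtain z where "p \<le> z" "z \<le> y" "f z = z"
        using orbit_bounded_imp_fixpoint[OF f continuous[OF G] p] by blast
      then show False using y[of z] by (auto simp: closed_segment_eq_real_ivl split: if_splits)
    qed
    have down: "\<exists>n. F n p \<le> y"
    proof (cases "p \<le> y")
      case True
      then show ?thesis by (intro exI[of _ 0]) (simp add: F_01)
    next
      case False
      show ?thesis
      proof (rule ccontr)
        assume neg: "\<not> ?thesis"
        \<comment> \<open>If \<open>y\<close> lay below every backward iterate of \<open>p\<close>,
          its forward orbit would stay below \<open>p\<close> and converge to a fixed point between
          them.\<close>
        have "(f ^^ n) y \<le> p" for n
        proof -
          have "F (int n) y < F (int n) (F (- int n) p)"
            by (rule strict_monoD[OF F(2)]) (use neg not_le in blast)
          then show ?thesis by (simp add: F_cancel flip: F_nat)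
        qed
        moreover have "y < f y"
        proof (rule ccontr)
          assume "\<not> y < f y"
          then have "\<exists>z. y \<le> z \<and> z \<le> p \<and> f z - z = 0"
            using p False by (intro IVT') (auto intro!: continuous_intros continuous[OF G])
          then show False using y False by (auto simp: closed_segment_eq_real_ivl)
        qed
        ultimately obtain z where "y \<le> z" "z \<le> p" "f z = z"
          using orbit_bounded_imp_fixpoint[OF f continuous[OF G]] by blast
        then show False using y[of z] by (auto simp: closed_segment_eq_real_ivl split: if_splits)
      qed
    qed
    have mono_int: "F m p < F n p \<longleftrightarrow> m < n" for m n
      using strict_mono_less[OF mono, of "of_int m" "of_int n"] by (simp add: k_int)
    obtain m n where mn: "F m p \<le> y" "y < F n p" using up down by blast
    have "\<exists>n. F n p \<le> y \<and> y < F (n + 1) p"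
    proof (rule ccontr)
      assume neg: "\<not> ?thesis"
      have "F j p \<le> y" if "m \<le> j" for j
        using that
      proof (induction j rule: int_ge_induct)
        case base then show ?case using mn by simp
      next
        case (step j) then show ?case using neg by (simp add: not_less)
      qed
      moreover have "m \<le> n" using mn mono_int[of n m] by linarith
      ultimately show False using mn(2) by (simp add: not_less[symmetric])
    qed
    then obtain n where n: "F n p \<le> y" "y < F n (f p)" by (auto simp: F_add F_01)
    \<comment> \<open>Pull \<open>y\<close> back to the fundamental domain from \<open>p\<close> to
      \<open>f p\<close>; its relative position there is the fractional part of the
      preimage.\<close>
    define u where "u = F (- n) y"
    have u: "p \<le> u" "u < f p"
      using n F_cancel strict_mono_less_eq[OF F(2), of "- n" "F n p" y]
        strict_mono_less[OF F(2), of "- n" y "F n (f p)"] by (simp_all add: u_def)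
    define t where "t = (u - p) / (f p - p)"
    have t: "0 \<le> t" "t < 1" using u p by (simp_all add: t_def divide_simps)
    have "\<lfloor>of_int n + t\<rfloor> = n" using t by (simp add: floor_eq_iff)
    then have "k (of_int n + t) = F n ((f p - p) * t + p)" by (simp add: k_def \<phi>_def algebra_simps)
    also have "(f p - p) * t + p = u" using p by (simp add: t_def)
    finally have "k (of_int n + t) = y" by (simp add: u_def F_cancel)
    then show "y \<in> range k" by blast
  qed
  moreover have "piecewise_affine k" if "G = PL_R"
  proof -
    have "piecewise_affine (\<phi> n)" for n
    proof -
      have "(\<lambda>x. (f p - p) * x + (p - (f p - p) * of_int n)) \<in> carrier PL_R"
        using p by (intro affine_mem_PL_R) simp
      then have "F n \<circ> (\<lambda>x. (f p - p) * x + (p - (f p - p) * of_int n)) \<in> carrier PL_R"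
        using F(1)[of n] that by (intro PL.comp_closed) simp_all
      then show ?thesis by (simp add: PL_R_iff comp_def \<phi>_def[abs_def])
    qed
    then show ?thesis unfolding k_def[abs_def] by (rule piecewise_affine_floor)
  qed
  ultimately show ?thesis using mono shift by blast
qed

subsection \<open>The translation as a product of two reversible maps\<close>

text \<open>The \<open>oscillation\<close> has slope 2 around its repelling fixed points \<open>\<int>\<close> and slope 1/2 around its
  attracting fixed points \<open>3/4 + \<int>\<close>; its reverser maps each interval between consecutive fixed
  points affinely onto the next one.\<close>

definition zigzag :: "real \<Rightarrow> real" where
  "zigzag r = max (min (2 * r) (r / 2 + 3 / 8)) (2 * r - 1)"

definition zigzag_reverser :: "real \<Rightarrow> real" where
  "zigzag_reverser r = max (r / 3 + 3 / 4) (3 * r - 5 / 4)"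

text \<open>When \<open>f 1 = f 0 + 1\<close>, this extends \<open>f\<close> from the unit interval
  so that it commutes with the translation by 1, as the lift of a circle map does.\<close>

definition periodic_extension :: "(real \<Rightarrow> real) \<Rightarrow> real \<Rightarrow> real" where
  "periodic_extension f x = of_int \<lfloor>x\<rfloor> + f (x - of_int \<lfloor>x\<rfloor>)"

lemma periodic_extension_eq:
  assumes "f 1 = f 0 + 1" "0 \<le> r" "r \<le> 1"
  shows "periodic_extension f (of_int n + r) = of_int n + f r"
proof (cases "r = 1")
  case True
  then have "of_int n + r = of_int (n + 1)" by simp
  then show ?thesis unfolding periodic_extension_def using True assms(1) by simp
next
  case False
  then have "\<lfloor>of_int n + r\<rfloor> = n" using assms by (simp add: floor_eq_iff)
  then show ?thesis by (simp add: periodic_extension_def)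
qed

lemma periodic_extension_shift:
  assumes "f 1 = f 0 + 1" "1 \<le> r" "r \<le> 2"
  shows "periodic_extension f (of_int n + r) = of_int n + 1 + f (r - 1)"
  using periodic_extension_eq[OF assms(1), of "r - 1" "n + 1"] assms(2,3) by simp

lemma periodic_extension_piecewise_affine:
  assumes "\<And>c. piecewise_affine (\<lambda>x. c + f (x - c))"
  shows "piecewise_affine (periodic_extension f)"
  unfolding periodic_extension_def[abs_def]
  using piecewise_affine_floor[of "\<lambda>n x. of_int n + f (x - of_int n)"] assms by simp

lemma strict_mono_periodic_extension:
  assumes "strict_mono f" "f 1 = f 0 + 1"
  shows "strict_mono (periodic_extension f)"
  unfolding periodic_extension_def[abs_def]
proof (rule strict_mono_floor_glue)
  show "strict_mono (\<lambda>x. real_of_int n + f (x - real_of_int n))" for n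
    using assms(1) by (simp add: strict_mono_def)
qed (use assms(2) in simp)

definition oscillation :: "real \<Rightarrow> real" where
  "oscillation = periodic_extension zigzag"

definition oscillation_reverser :: "real \<Rightarrow> real" where
  "oscillation_reverser = periodic_extension zigzag_reverser"

lemma zigzag_1: "zigzag 1 = zigzag 0 + 1" "zigzag_reverser 1 = zigzag_reverser 0 + 1"
  by (simp_all add: zigzag_def zigzag_reverser_def max_def min_def)

lemma oscillation_eq:
  "0 \<le> r \<Longrightarrow> r \<le> 1 \<Longrightarrow> oscillation (of_int n + r) = of_int n + zigzag r"
  "1 \<le> r \<Longrightarrow> r \<le> 2 \<Longrightarrow> oscillation (of_int n + r) = of_int n + 1 + zigzag (r - 1)"
  by (simp_all only: oscillation_def periodic_extension_eq[OF zigzag_1(1)] periodic_extension_shift[OF zigzag_1(1)])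

lemma oscillation_reverser_eq:
  "0 \<le> r \<Longrightarrow> r \<le> 1 \<Longrightarrow> oscillation_reverser (of_int n + r) = of_int n + zigzag_reverser r"
  "1 \<le> r \<Longrightarrow> r \<le> 2 \<Longrightarrow> oscillation_reverser (of_int n + r) = of_int n + 1 + zigzag_reverser (r - 1)"
  by (simp_all only: oscillation_reverser_def periodic_extension_eq[OF zigzag_1(2)] periodic_extension_shift[OF zigzag_1(2)])

text \<open>The breaks are where the lines of slope 2 and 1/2 through the fixed points
  \<open>0\<close>, \<open>3 / 4\<close> and \<open>1\<close> meet. Listing the pieces turns
  identities between compositions into linear arithmetic.\<close>

lemma zigzag_cases:
  "r \<le> 1 / 4 \<and> zigzag r = 2 * r \<or> 1 / 4 \<le> r \<and> r \<le> 11 / 12 \<and> zigzag r = r / 2 + 3 / 8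
    \<or> 11 / 12 \<le> r \<and> zigzag r = 2 * r - 1"
  by (auto simp: zigzag_def max_def min_def)

lemma zigzag_reverser_cases:
  "r \<le> 3 / 4 \<and> zigzag_reverser r = r / 3 + 3 / 4 \<or> 3 / 4 \<le> r \<and> zigzag_reverser r = 3 * r - 5 / 4"
  by (auto simp: zigzag_reverser_def max_def)

lemma zigzag_bounds:
  assumes "0 \<le> r" "r \<le> 1"
  shows "0 \<le> zigzag r" "zigzag r \<le> 1" "3 / 4 \<le> zigzag_reverser r" "zigzag_reverser r \<le> 7 / 4"
  using assms by (auto simp: zigzag_def zigzag_reverser_def max_def min_def)

text \<open>The reverser exchanges the repelling and the attracting fixed points, as passing from
  \<open>oscillation\<close> to its inverse does.\<close>

lemma oscillation_reversed:
  "oscillation (oscillation_reverser (oscillation x)) = oscillation_reverser x"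
proof -
  define n r where "n = \<lfloor>x\<rfloor>" and "r = x - of_int \<lfloor>x\<rfloor>"
  have x: "x = of_int n + r" and r: "0 \<le> r" "r \<le> 1" by (simp_all add: n_def r_def) linarith
  define s where "s = zigzag_reverser (zigzag r)"
  have s: "3 / 4 \<le> s" "s \<le> 7 / 4" using zigzag_bounds[of "zigzag r"] zigzag_bounds[OF r] by (simp_all add: s_def)
  have "oscillation_reverser (oscillation x) = of_int n + s"
    unfolding x using r zigzag_bounds[OF r] by (simp add: oscillation_eq oscillation_reverser_eq s_def)
  also have "oscillation \<dots> = of_int n + zigzag_reverser r"
  \<comment> \<open>The intermediate value \<open>s\<close> may have moved into the next period,
    where the formula is applied to \<open>s - 1\<close>.\<close>
  proof (cases "s \<le> 1")
    case True
    then have "oscillation (of_int n + s) = of_int n + zigzag s" using s by (simp add: oscillation_eq)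
    also have "zigzag s = zigzag_reverser r"
      using True r s_def zigzag_cases[of r] zigzag_reverser_cases[of "zigzag r"] zigzag_cases[of s]
        zigzag_reverser_cases[of r] by - (elim disjE conjE, linarith+)
    finally show ?thesis .
  next
    case False
    define u where "u = s - 1"
    then have s_u: "s = 1 + u" by simp
    then have "oscillation (of_int n + s) = of_int n + (1 + zigzag u)"
      using s False by (simp add: oscillation_eq)
    also have "1 + zigzag u = zigzag_reverser r"
      using False r s_def s_u zigzag_cases[of r] zigzag_reverser_cases[of "zigzag r"] zigzag_cases[of u]
        zigzag_reverser_cases[of r] by - (elim disjE conjE, linarith+)
    finally show ?thesis by simp
  qed
  also have "\<dots> = oscillation_reverser x" unfolding x using r by (simp add: oscillation_reverser_eq)
  finally show ?thesis .
qed

text \<open>Two applications carry an interval between fixed points to its translate one period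
  later, with slopes 1/3 and 3 that cancel.\<close>

lemma oscillation_reverser_twice: "oscillation_reverser (oscillation_reverser x) = x + 1"
proof -
  define n r where "n = \<lfloor>x\<rfloor>" and "r = x - of_int \<lfloor>x\<rfloor>"
  have x: "x = of_int n + r" and r: "0 \<le> r" "r \<le> 1" by (simp_all add: n_def r_def) linarith
  define s where "s = zigzag_reverser r"
  have s: "3 / 4 \<le> s" "s \<le> 7 / 4" using zigzag_bounds[OF r] by (simp_all add: s_def)
  have "oscillation_reverser x = of_int n + s"
    unfolding x using r by (simp add: oscillation_reverser_eq s_def)
  also have "oscillation_reverser \<dots> = of_int n + (1 + r)"
  proof (cases "s \<le> 1")
    case True
    then have "oscillation_reverser (of_int n + s) = of_int n + zigzag_reverser s"
      using s by (simp add: oscillation_reverser_eq)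
    also have "zigzag_reverser s = 1 + r"
      using True r s_def zigzag_reverser_cases[of r] zigzag_reverser_cases[of s] by - (elim disjE conjE, linarith+)
    finally show ?thesis .
  next
    case False
    define u where "u = s - 1"
    then have s_u: "s = 1 + u" by simp
    then have "oscillation_reverser (of_int n + s) = of_int n + 1 + zigzag_reverser u"
      using s False by (simp add: oscillation_reverser_eq)
    also have "zigzag_reverser u = r"
      using False r s_def s_u zigzag_reverser_cases[of r] zigzag_reverser_cases[of u] by - (elim disjE conjE, linarith+)
    finally show ?thesis by simp
  qed
  finally show ?thesis by (simp add: x)
qed

text \<open>The shift \<open>5 / 12\<close> makes the slopes cancel: \<open>oscillation\<close> maps
  \<open>[-1/12, 1/4]\<close>, where its slope is 2, onto \<open>[-1/6, 1/2]\<close>, which is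
  shifted onto \<open>[1/4, 11/12]\<close>, where the slope is 1/2. It maps the latter interval onto
  \<open>[1/2, 5/6]\<close>, which is shifted onto \<open>[11/12, 5/4]\<close>, where the slope is 2
  again.\<close>

lemma oscillation_translated: "oscillation (oscillation x + 5 / 12) = x + 7 / 12"
proof -
  define n r where "n = \<lfloor>x\<rfloor>" and "r = x - of_int \<lfloor>x\<rfloor>"
  have x: "x = of_int n + r" and r: "0 \<le> r" "r \<le> 1" by (simp_all add: n_def r_def) linarith
  define s where "s = zigzag r + 5 / 12"
  have s: "0 \<le> s" "s \<le> 2" using zigzag_bounds[OF r] by (simp_all add: s_def)
  have "oscillation x + 5 / 12 = of_int n + s"
    unfolding x using r by (simp add: oscillation_eq s_def)
  also have "oscillation \<dots> = of_int n + (r + 7 / 12)"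
  proof (cases "s \<le> 1")
    case True
    then have "oscillation (of_int n + s) = of_int n + zigzag s" using s by (simp add: oscillation_eq)
    also have "zigzag s = r + 7 / 12"
      using True r s_def zigzag_cases[of r] zigzag_cases[of s] by - (elim disjE conjE, linarith+)
    finally show ?thesis .
  next
    case False
    define u where "u = s - 1"
    then have s_u: "s = 1 + u" by simp
    then have "oscillation (of_int n + s) = of_int n + (1 + zigzag u)"
      using s False by (simp add: oscillation_eq)
    also have "1 + zigzag u = r + 7 / 12"
      using False r s_def s_u zigzag_cases[of r] zigzag_cases[of u] by - (elim disjE conjE, linarith+)
    finally show ?thesis by simp
  qed
  finally show ?thesis by (simp add: x)
qed

lemma oscillation_mem: "oscillation \<in> carrier (orientation_preserving PL_R)"
  and oscillation_reverser_mem: "oscillation_reverser \<in> carrier (orientation_preserving PL_R)"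
proof -
  have mono: "strict_mono oscillation" "strict_mono oscillation_reverser"
    unfolding oscillation_def oscillation_reverser_def
    by (intro strict_mono_periodic_extension zigzag_1 strict_monoI,
        simp add: zigzag_def zigzag_reverser_def max_def min_def)+
  \<comment> \<open>Right inverses are read off from the two identities, since applying the reverser
    twice to \<open>y - 1\<close> gives \<open>y\<close>.\<close>
  have surj: "oscillation_reverser (oscillation_reverser (y - 1)) = y"
    "oscillation (oscillation_reverser (oscillation (oscillation_reverser (y - 1)))) = y" for y
    by (simp_all add: oscillation_reverser_twice oscillation_reversed)
  have "(\<lambda>x. c + zigzag (x - c)) =
      (\<lambda>x. max (min (2 * x + - c) (1 / 2 * x + (c / 2 + 3 / 8))) (2 * x + (- c - 1)))" for c
    by (auto simp: fun_eq_iff zigzag_def max_def min_def field_simps)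
  moreover have "(\<lambda>x. c + zigzag_reverser (x - c)) =
      (\<lambda>x. max (1 / 3 * x + (2 * c / 3 + 3 / 4)) (3 * x + (- 2 * c - 5 / 4)))" for c
    by (auto simp: fun_eq_iff zigzag_reverser_def max_def field_simps)
  ultimately have "piecewise_affine oscillation" "piecewise_affine oscillation_reverser"
    unfolding oscillation_def oscillation_reverser_def
    by (auto intro!: periodic_extension_piecewise_affine piecewise_affine_max piecewise_affine_min
        simp only: piecewise_affine_affine)
  with mono strict_mono_surj_homeo_R[OF mono(1) surj(2)] strict_mono_surj_homeo_R[OF mono(2) surj(1)]
  show "oscillation \<in> carrier (orientation_preserving PL_R)"
    "oscillation_reverser \<in> carrier (orientation_preserving PL_R)"
    by (auto simp: PL_R_iff)
qed

lemma conjugate_strict_mono: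
  fixes k :: "real \<Rightarrow> real"
  assumes k: "strict_mono k \<or> strict_antimono_on UNIV k" and k': "\<And>x. k (k' x) = x"
    and u: "strict_mono u"
  shows "strict_mono (k \<circ> u \<circ> k')"
  using k
proof
  assume k: "strict_mono k"
  show ?thesis
    by (intro strict_monoI) (metis k' comp_apply strict_mono_less[OF k] strict_monoD[OF u])
next
  assume k: "strict_antimono_on UNIV k"
  then have anti: "k x < k y \<longleftrightarrow> y < x" for x y by (rule strict_antimono_less)
  show ?thesis
    by (intro strict_monoI) (metis k' comp_apply anti strict_monoD[OF u])
qed

text \<open>PL+ is normal in PL. The conjugating map may be decreasing, as happens for the conjugacy
  of a map that moves points down to the translation.\<close>

lemma PL_plus_conjugate_reversible:
  assumes u: "reversible (orientation_preserving PL_R) u" and k: "k \<in> carrier PL_R"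
    and k': "k' \<in> carrier PL_R" "\<And>x. k (k' x) = x" "\<And>x. k' (k x) = x"
  shows "reversible (orientation_preserving PL_R) (k \<circ> u \<circ> k')"
proof -
  obtain h where uP: "u \<in> carrier (orientation_preserving PL_R)"
    and h: "h \<in> carrier (orientation_preserving PL_R)" and rev: "\<And>x. u (h (u x)) = h x"
    using PL_plus.reversibleE[OF u] by blast
  have "strict_mono k \<or> strict_antimono_on UNIV k"
    using k by (intro strict_mono_or_antimono) (simp add: PL_R_iff)
  note sm = conjugate_strict_mono[OF this k'(2)]
  have "k \<circ> v \<circ> k' \<in> carrier (orientation_preserving PL_R)"
    if "v \<in> carrier (orientation_preserving PL_R)" for v
    using that sm[of v] PL.comp_closed[OF PL.comp_closed[OF k] k'(1), of v] by auto
  from this[OF uP] this[OF h] show ?thesis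
    by (rule PL_plus.reversibleI) (simp add: k' rev)
qed

lemma translation_eq_mult_reversible:
  obtains a b where "reversible (orientation_preserving PL_R) a"
    "reversible (orientation_preserving PL_R) b" "\<And>x. a (b x) = x + 1"
proof -
  have osc: "reversible (orientation_preserving PL_R) oscillation"
    by (rule PL_plus.reversibleI[OF oscillation_mem oscillation_reverser_mem oscillation_reversed])
  \<comment> \<open>By \<open>oscillation_translated\<close>, conjugating the inner factor by the
    shift \<open>5 / 12\<close> yields a translation by 7/12 - 5/12 = 1/6, which the factor 6
    rescales to 1. The terms \<open>+ 0\<close> keep the shape of
    \<open>affine_mem_PL_R\<close>.\<close>
  let ?a = "(\<lambda>x. 6 * x + 0) \<circ> oscillation \<circ> (\<lambda>x. 1 / 6 * x + 0)"
  let ?b = "(\<lambda>x. 6 * x + 5 / 2) \<circ> oscillation \<circ> (\<lambda>x. 1 / 6 * x + - 5 / 12)"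
  have "reversible (orientation_preserving PL_R) ?a"
    by (intro PL_plus_conjugate_reversible osc affine_mem_PL_R) simp_all
  moreover have "reversible (orientation_preserving PL_R) ?b"
    by (intro PL_plus_conjugate_reversible osc affine_mem_PL_R) (simp_all add: field_simps)
  moreover have "?a (?b x) = x + 1" for x
  proof -
    have "?a (?b x) = 6 * oscillation (oscillation (1 / 6 * x + - 5 / 12) + 5 / 12)"
      by (simp add: field_simps)
    then show ?thesis unfolding oscillation_translated by (simp add: field_simps)
  qed
  ultimately show thesis by (rule that)
qed

subsection \<open>Factorisations in H and PL\<close>

lemma affine_mem:
  assumes "G = homeo_R \<or> G = PL_R" "c \<noteq> 0"
  shows "(\<lambda>x. c * x + d) \<in> carrier G"
  using affine_mem_PL_R[OF assms(2), of d] assms(1) by (auto simp only: PL_R_iff)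

text \<open>Without fixed points the component reached by the conjugacy is the whole line. If
  \<open>f\<close> moves points down, its inverse is conjugated instead and a reflection restores
  the direction.\<close>

lemma fixpoint_free_conjugate:
  assumes G: "G = homeo_R \<or> G = PL_R" and f: "f \<in> carrier G" "strict_mono f" and free: "\<And>x. f x \<noteq> x"
  obtains k where "k \<in> carrier G" "\<And>x. k (x + 1) = f (k x)"
proof -
  interpret homeo_group G using G homeo_group_homeo_R homeo_group_PL_R by blast
  have *: "\<exists>k\<in>carrier G. \<forall>x. k (x + 1) = g (k x)"
    if g: "g \<in> carrier G" "strict_mono g" and free: "\<And>x. g x \<noteq> x" and pos: "0 < g 0" for g
  proof -
    obtain k where k: "strict_mono k" "\<And>x. k (x + 1) = g (k x)"
      "range k = {y. \<forall>z\<in>closed_segment 0 y. g z \<noteq> z}" "G = PL_R \<Longrightarrow> piecewise_affine k"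
      using ex_translation_conjugacy[OF g pos] by blast
    have "range k = UNIV" using k(3) free by auto
    then have "k \<in> carrier homeo_R"
      by (intro strict_mono_surj_homeo_R[OF k(1), of "inv_into UNIV k"]) (simp add: f_inv_into_f)
    then have "k \<in> carrier G" using G k(4) by (auto simp: PL_R_iff)
    with k(2) show ?thesis by blast
  qed
  consider "0 < f 0" | "f 0 < 0" using free[of 0] by linarith
  then show thesis
  proof cases
    case 1
    then show thesis using *[OF f free] that by blast
  next
    case 2
    obtain f' where f': "f' \<in> carrier G" "\<And>x. f' (f x) = x" "\<And>x. f (f' x) = x"
      using inverseE[OF f(1)] by blast
    have mono': "strict_mono f'" by (rule strict_mono_right_inverse[OF f(2) f'(3)])
    have free': "f' x \<noteq> x" for x using free f' by metis
    have "0 < f' 0" using strict_monoD[OF mono' 2] by (simp add: f')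
    then obtain k where k: "k \<in> carrier G" "\<And>x. k (x + 1) = f' (k x)"
      using *[OF f'(1) mono' free'] by blast
    have "(\<lambda>x. - 1 * x + 0) \<in> carrier G"
      by (rule affine_mem[OF G]) simp
    then have "k \<circ> (\<lambda>x. - 1 * x + 0) \<in> carrier G" by (rule comp_closed[OF k(1)])
    moreover have "(k \<circ> (\<lambda>x. - 1 * x + 0)) (x + 1) = f ((k \<circ> (\<lambda>x. - 1 * x + 0)) x)" for x
      using k(2)[of "- x - 1"] by (simp add: f')
    ultimately show thesis by (rule that)
  qed
qed

lemma fixpoint_free_reversible:
  assumes G: "G = homeo_R \<or> G = PL_R" and f: "f \<in> carrier G" "strict_mono f" and free: "\<And>x. f x \<noteq> x"
  shows "reversible G f"
proof -
  interpret homeo_group G using G homeo_group_homeo_R homeo_group_PL_R by blast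
  obtain k where k: "k \<in> carrier G" "\<And>x. k (x + 1) = f (k x)"
    using fixpoint_free_conjugate[OF G f free] by blast
  obtain k' where k': "k' \<in> carrier G" "\<And>x. k' (k x) = x" "\<And>x. k (k' x) = x"
    using inverseE[OF k(1)] by blast
  have "(\<lambda>x. - 1 * x + 0) \<in> carrier G"
    by (rule affine_mem[OF G]) simp
  then have "k \<circ> (\<lambda>x. - 1 * x + 0) \<circ> k' \<in> carrier G" by (intro comp_closed k k')
  with f(1) show ?thesis
  proof (rule reversibleI)
    fix x
    have "k' (f x) = k' x + 1" by (metis k(2) k'(2,3))
    then show "f ((k \<circ> (\<lambda>x. - 1 * x + 0) \<circ> k') (f x)) = (k \<circ> (\<lambda>x. - 1 * x + 0) \<circ> k') x"
      by (simp flip: k(2))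
  qed
qed

lemma fixpoint_free_mult_reversible_PL_plus:
  assumes f: "f \<in> carrier PL_R" "strict_mono f" and free: "\<And>x. f x \<noteq> x"
  obtains a b where "reversible (orientation_preserving PL_R) a"
    "reversible (orientation_preserving PL_R) b" "f = a \<circ> b"
proof -
  obtain k where k: "k \<in> carrier PL_R" "\<And>x. k (x + 1) = f (k x)"
    using fixpoint_free_conjugate[OF _ f free] by blast
  obtain k' where k': "k' \<in> carrier PL_R" "\<And>x. k' (k x) = x" "\<And>x. k (k' x) = x"
    using PL.inverseE[OF k(1)] by blast
  obtain a b where ab: "reversible (orientation_preserving PL_R) a"
    "reversible (orientation_preserving PL_R) b" "\<And>x. a (b x) = x + 1"
    using translation_eq_mult_reversible by blast
  have "f = (k \<circ> a \<circ> k') \<circ> (k \<circ> b \<circ> k')"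
    by (simp add: fun_eq_iff k' ab(3) k(2))
  then show thesis
    using that PL_plus_conjugate_reversible[OF _ k(1) k'(1,3,2)] ab(1,2) by blast
qed

lemma max_mem:
  assumes "G = homeo_R \<or> G = PL_R" "f \<in> carrier G" "g \<in> carrier G" "strict_mono f" "strict_mono g"
  shows "(\<lambda>x. max (f x) (g x)) \<in> carrier G"
proof -
  have "f \<in> carrier homeo_R" "g \<in> carrier homeo_R" using assms by (auto simp: PL_R_iff)
  then have "(\<lambda>x. max (f x) (g x)) \<in> carrier homeo_R" using assms by (intro max_mem_homeo_R) auto
  then show ?thesis using assms(1-3) by (auto simp: PL_R_iff piecewise_affine_max)
qed

lemma strict_mono_eq_fixpoint_free_mult:
  assumes G: "G = homeo_R \<or> G = PL_R" and f: "f \<in> carrier G" "strict_mono f"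
  obtains a b where "a \<in> carrier G" "strict_mono a" "\<And>x. a x \<noteq> x"
    "b \<in> carrier G" "strict_mono b" "\<And>x. b x \<noteq> x" "f = a \<circ> b"
proof -
  interpret homeo_group G using G homeo_group_homeo_R homeo_group_PL_R by blast
  have "(\<lambda>x. 1 * x + 1) \<in> carrier G"
    by (rule affine_mem[OF G]) simp
  moreover have "(\<lambda>x. max (f x) (id x)) \<in> carrier G"
    by (rule max_mem[OF G f(1) id_closed f(2)]) (simp add: strict_mono_def)
  ultimately have "(\<lambda>x. 1 * x + 1) \<circ> (\<lambda>x. max (f x) (id x)) \<in> carrier G" by (rule comp_closed)
  then have a: "(\<lambda>x. max (f x) x + 1) \<in> carrier G" by (simp add: comp_def)
  \<comment> \<open>Exceeding the identity makes \<open>a\<close> fixed point free; exceeding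
    \<open>f\<close> makes \<open>a' \<circ> f\<close> move every point down.\<close>
  define a where "a x = max (f x) x + 1" for x
  have aG: "a \<in> carrier G" using a by (simp add: a_def[abs_def])
  have a_mono: "strict_mono a"
  proof (rule strict_monoI)
    fix x y :: real assume "x < y"
    then show "a x < a y" using strict_monoD[OF f(2) \<open>x < y\<close>] by (simp add: a_def max_def)
  qed
  obtain a' where a': "a' \<in> carrier G" "\<And>x. a' (a x) = x" "\<And>x. a (a' x) = x"
    using inverseE[OF aG] by blast
  have a'_mono: "strict_mono a'" by (rule strict_mono_right_inverse[OF a_mono a'(3)])
  have less: "a' (f x) < x" for x
    using strict_monoD[OF a'_mono, of "f x" "a x"] by (simp add: a') (simp add: a_def)
  show thesis
  proof (rule that[OF aG a_mono])
    show "a' \<circ> f \<in> carrier G" by (rule comp_closed[OF a'(1) f(1)])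
    show "strict_mono (a' \<circ> f)" using a'_mono f(2) by (simp add: strict_mono_def)
    show "f = a \<circ> (a' \<circ> f)" by (simp add: fun_eq_iff a')
    show "(a' \<circ> f) x \<noteq> x" for x using less[of x] by simp
    show "a x \<noteq> x" for x by (simp add: a_def)
  qed
qed

text \<open>The region above the graphs of \<open>f\<close> and \<open>f\<inverse>\<close> is symmetric in the diagonal,
  so its boundary is the graph of an involution.\<close>

lemma strict_antimono_eq_involution_mult_fixpoint_free:
  assumes G: "G = homeo_R \<or> G = PL_R" and f: "f \<in> carrier G" "strict_antimono_on UNIV f"
  obtains t g where "involution G t" "g \<in> carrier G" "strict_mono g" "\<And>x. g x \<noteq> x" "f = t \<circ> g"
proof -
  interpret homeo_group G using G homeo_group_homeo_R homeo_group_PL_R by blast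
  obtain f' where f': "f' \<in> carrier G" "\<And>x. f' (f x) = x" "\<And>x. f (f' x) = x"
    using inverseE[OF f(1)] by blast
  have anti: "f x < f y \<longleftrightarrow> y < x" for x y by (rule strict_antimono_less[OF f(2)])
  have anti': "f' x < f' y \<longleftrightarrow> y < x" for x y by (metis anti f'(3))
  have anti_le: "f x \<le> f y \<longleftrightarrow> y \<le> x" "f' x \<le> f' y \<longleftrightarrow> y \<le> x" for x y
    using anti[of y x] anti'[of y x] by linarith+
  define m where "m x = max (f x) (f' x)" for x
  have m_less: "m y < m x" if "x < y" for x y
    using that anti[of y x] anti'[of y x] by (simp add: m_def max_def)
  have mm: "m (m x) = x" for x
  proof (cases "f' x \<le> f x")
    case True
    then have "m x = f x" by (simp add: m_def)
    moreover have "f (f x) \<le> x" using anti_le(1)[of "f x" "f' x"] True by (simp add: f')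
    ultimately show ?thesis by (simp add: m_def[of "f x"] f')
  next
    case False
    then have "m x = f' x" by (simp add: m_def)
    moreover have "f' (f' x) \<le> x" using anti_le(2)[of "f' x" "f x"] False by (simp add: f')
    ultimately show ?thesis by (simp add: m_def[of "f' x"] f')
  qed
  have "continuous_on UNIV m"
    unfolding m_def[abs_def] by (intro continuous_intros continuous f(1) f'(1))
  then have "homeomorphism UNIV UNIV m m" using mm by (auto simp: homeomorphism_def intro!: surjI)
  then have "m \<in> carrier homeo_R" by auto
  moreover have "piecewise_affine m" if "G = PL_R"
    unfolding m_def[abs_def] using that f(1) f'(1) by (intro piecewise_affine_max) (simp_all add: PL_R_iff)
  ultimately have m: "m \<in> carrier G" using G by (auto simp: PL_R_iff)
  have aff: "(\<lambda>x. 1 * x + 1) \<in> carrier G" "(\<lambda>x. 1 * x + - 1) \<in> carrier G"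
    by (rule affine_mem[OF G], simp)+
  \<comment> \<open>Conjugating by the translation keeps the involution but shifts the decreasing
    graph of \<open>m\<close> along the diagonal, strictly above that of \<open>f'\<close>; hence
    \<open>t \<circ> f\<close> moves every point up.\<close>
  define t where "t = (\<lambda>x. 1 * x + 1) \<circ> m \<circ> (\<lambda>x. 1 * x + - 1)"
  have tG: "t \<in> carrier G" unfolding t_def by (intro comp_closed m aff)
  have tt: "t (t x) = x" for x by (simp add: t_def mm)
  have t_less: "t y < t x" if "x < y" for x y using that by (simp add: t_def m_less)
  have "f' y < t y" for y
    using m_less[of "y - 1" y] by (simp add: t_def) (simp add: m_def)
  from this[of "f _"] have free: "x < t (f x)" for x by (simp add: f')
  show thesis
  proof (rule that)
    show "involution G t" using tG tt by (simp add: involution_def fun_eq_iff)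
    show "t \<circ> f \<in> carrier G" by (rule comp_closed[OF tG f(1)])
    show "strict_mono (t \<circ> f)" by (rule strict_monoI) (simp add: t_less anti)
    show "(t \<circ> f) x \<noteq> x" for x using free[of x] by simp
    show "f = t \<circ> (t \<circ> f)" by (simp add: fun_eq_iff tt)
  qed
qed

lemma carrier_subset_reversible_products_2:
  assumes G: "G = homeo_R \<or> G = PL_R"
  shows "carrier G \<subseteq> reversible_products G 2"
proof
  interpret homeo_group G using G homeo_group_homeo_R homeo_group_PL_R by blast
  fix f assume f: "f \<in> carrier G"
  then have "f \<in> carrier homeo_R" using G by (auto simp: PL_R_iff)
  from strict_mono_or_antimono[OF this] show "f \<in> reversible_products G 2"
  proof
    assume "strict_mono f"
    then obtain a b where "a \<in> carrier G" "strict_mono a" "\<And>x. a x \<noteq> x"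
      "b \<in> carrier G" "strict_mono b" "\<And>x. b x \<noteq> x" "f = a \<circ> b"
      using strict_mono_eq_fixpoint_free_mult[OF G f] by blast
    then show ?thesis
      using mult_mem_reversible_products_2[of a b] fixpoint_free_reversible[OF G] by simp
  next
    assume "strict_antimono_on UNIV f"
    then obtain t g where "involution G t" "g \<in> carrier G" "strict_mono g" "\<And>x. g x \<noteq> x" "f = t \<circ> g"
      using strict_antimono_eq_involution_mult_fixpoint_free[OF G f] by blast
    then show ?thesis
      using mult_mem_reversible_products_2[of t g] fixpoint_free_reversible[OF G]
        involution_imp_reversible by simp
  qed
qed

lemma carrier_PL_plus_subset_reversible_products_4:
  "carrier (orientation_preserving PL_R) \<subseteq> reversible_products (orientation_preserving PL_R) 4"
proof
  fix f assume "f \<in> carrier (orientation_preserving PL_R)"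
  then have f: "f \<in> carrier PL_R" "strict_mono f" by auto
  obtain a b where a: "a \<in> carrier PL_R" "strict_mono a" "\<And>x. a x \<noteq> x"
    and b: "b \<in> carrier PL_R" "strict_mono b" "\<And>x. b x \<noteq> x" and ab: "f = a \<circ> b"
    using strict_mono_eq_fixpoint_free_mult[OF _ f] by blast
  obtain a1 a2 where "reversible (orientation_preserving PL_R) a1"
    "reversible (orientation_preserving PL_R) a2" "a = a1 \<circ> a2"
    using fixpoint_free_mult_reversible_PL_plus[OF a] .
  moreover obtain b1 b2 where "reversible (orientation_preserving PL_R) b1"
    "reversible (orientation_preserving PL_R) b2" "b = b1 \<circ> b2"
    using fixpoint_free_mult_reversible_PL_plus[OF b] .
  ultimately show "f \<in> reversible_products (orientation_preserving PL_R) 4"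
    using PL_plus.mult_mem_reversible_products_4[of a1 a2 b1 b2] by (simp add: ab)
qed

subsection \<open>Factorisation in H+\<close>

context
  fixes f :: "real \<Rightarrow> real"
  assumes f: "f \<in> carrier homeo_R" "strict_mono f"
begin

text \<open>This is the connected component of \<open>p\<close> in the set of moved points, and it
  is empty if \<open>p\<close> is fixed.\<close>

definition moved_component :: "real \<Rightarrow> real set" where
  "moved_component p = {y. \<forall>z\<in>closed_segment p y. f z \<noteq> z}"

lemma moved_component_self: "x \<in> moved_component x \<longleftrightarrow> f x \<noteq> x"
  by (simp add: moved_component_def)

lemma moved_component_moved: "y \<in> moved_component x \<Longrightarrow> f y \<noteq> y"
  by (simp add: moved_component_def)

lemma moved_component_eq:
  assumes "y \<in> moved_component x"
  shows "moved_component y = moved_component x"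
proof -
  have "w \<in> moved_component v" if "u \<in> moved_component v" "w \<in> moved_component u" for u v w
    using that by (auto simp: moved_component_def closed_segment_eq_real_ivl split: if_splits)
  moreover have "x \<in> moved_component y" using assms by (simp add: moved_component_def closed_segment_commute)
  ultimately show ?thesis using assms by blast
qed

text \<open>A chart identifies a component with the line so that \<open>f\<close> becomes the
  translation by 1. Decreasing charts occur where \<open>f\<close> moves points down.\<close>

definition is_chart :: "(real \<Rightarrow> real) \<Rightarrow> real set \<Rightarrow> bool" where
  "is_chart k S \<longleftrightarrow> (strict_mono k \<or> strict_antimono_on UNIV k) \<and> (\<forall>x. k (x + 1) = f (k x)) \<and> range k = S"

lemma is_chart_exists:
  assumes p: "f p \<noteq> p"
  shows "\<exists>k. is_chart k (moved_component p)"
proof (cases "p < f p")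
  case True
  from Homeo.ex_translation_conjugacy[OF f True] show ?thesis
    unfolding moved_component_def is_chart_def by (elim exE conjE) (intro exI conjI disjI1)
next
  case False
  obtain f' where f': "f' \<in> carrier homeo_R" "\<And>x. f' (f x) = x" "\<And>x. f (f' x) = x"
    using Homeo.inverseE[OF f(1)] by blast
  have mono': "strict_mono f'" by (rule strict_mono_right_inverse[OF f(2) f'(3)])
  have fixed: "f' z = z \<longleftrightarrow> f z = z" for z using f' by metis
  have "p < f' p" using False p strict_monoD[OF mono', of "f p" p] f' by simp
  from Homeo.ex_translation_conjugacy[OF f'(1) mono' this]
  obtain k where k: "strict_mono k \<and> (\<forall>x. k (x + 1) = f' (k x)) \<and> range k = moved_component p
      \<and> (homeo_R = PL_R \<longrightarrow> piecewise_affine k)"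
    unfolding moved_component_def fixed by (elim exE)
  define l where "l x = k (- x)" for x
  have "strict_antimono_on UNIV l"
    using k by (simp add: l_def monotone_on_def)
  moreover have "l (x + 1) = f (l x)" for x 
    using k[THEN conjunct2, THEN conjunct1, rule_format, of "- x - 1"] by (simp add: l_def f')
  moreover have "range l = range k"
    unfolding l_def[abs_def] by (simp add: surj_uminus flip: image_image[of k uminus])
  ultimately show ?thesis using k unfolding is_chart_def by (intro exI[of _ l]) simp
qed

text \<open>The choice depends on \<open>p\<close> only through its component, so all points of a
  component share one chart.\<close>

definition chart :: "real \<Rightarrow> real \<Rightarrow> real" where
  "chart p = (SOME k. is_chart k (moved_component p))"

lemma chart_spec:
  assumes "f p \<noteq> p"
  shows "strict_mono (chart p) \<or> strict_antimono_on UNIV (chart p)"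
    "chart p (x + 1) = f (chart p x)" "range (chart p) = moved_component p"
  using someI_ex[OF is_chart_exists[OF assms]] unfolding chart_def is_chart_def by auto

lemma chart_cong: "y \<in> moved_component x \<Longrightarrow> chart y = chart x"
  by (simp add: chart_def moved_component_eq)

lemma inj_chart: "f p \<noteq> p \<Longrightarrow> inj (chart p)"
  using chart_spec(1)[of p] by (auto simp: strict_mono_imp_inj_on strict_antimono_iff_antimono)

text \<open>Copying \<open>u\<close> to every component is multiplicative in \<open>u\<close> and
  sends the translation by 1 to \<open>f\<close>, so a factorisation of the translation becomes one
  of \<open>f\<close>.\<close>

definition act_by_charts :: "(real \<Rightarrow> real) \<Rightarrow> real \<Rightarrow> real" where
  "act_by_charts u x = (if f x = x then x else chart x (u (inv_into UNIV (chart x) x)))"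

lemma chart_inv:
  assumes "f p \<noteq> p" "x \<in> moved_component p"
  shows "chart p (inv_into UNIV (chart p) x) = x"
  using assms chart_spec(3) by (metis f_inv_into_f)

lemma act_by_charts_component: "f x \<noteq> x \<Longrightarrow> act_by_charts u x \<in> moved_component x"
  using chart_spec(3)[of x] by (auto simp: act_by_charts_def)

text \<open>The image of \<open>x\<close> stays in its component, so the same chart is used twice
  and cancels in the middle.\<close>

lemma act_by_charts_comp: "act_by_charts u (act_by_charts v x) = act_by_charts (u \<circ> v) x"
proof (cases "f x = x")
  case False
  note C = act_by_charts_component[OF False, of v]
  show ?thesis
    using moved_component_moved[OF C] chart_cong[OF C] False
    by (simp add: act_by_charts_def inv_into_f_f[OF inj_chart])
qed (simp add: act_by_charts_def)

lemma act_by_charts_id: "act_by_charts id x = x"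
  using chart_inv[of x x] by (simp add: act_by_charts_def moved_component_self)

lemma act_by_charts_translation: "act_by_charts (\<lambda>x. x + 1) x = f x"
  using chart_inv[of x x] chart_spec(2)[of x] by (simp add: act_by_charts_def moved_component_self)

text \<open>Within a component the order is compared in the chart, where a decreasing chart reverses
  it twice. Otherwise a fixed point \<open>z\<close> separates \<open>x\<close> from
  \<open>y\<close>, and neither image crosses it.\<close>

lemma strict_mono_act_by_charts:
  assumes u: "strict_mono u"
  shows "strict_mono (act_by_charts u)"
proof (rule strict_monoI)
  fix x y :: real assume less: "x < y"
  let ?a = "act_by_charts u"
  show "?a x < ?a y"
  proof (cases "f x \<noteq> x \<and> y \<in> moved_component x")
    case True
    define k where "k = chart x"
    define i where "i = inv_into UNIV k"
    have a: "?a x = k (u (i x))" "?a y = k (u (i y))"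
      using True moved_component_moved[of y x] chart_cong[of y x] by (simp_all add: act_by_charts_def k_def i_def)
    have i: "k (i x) = x" "k (i y) = y"
      using True chart_inv[of x] by (simp_all add: k_def i_def moved_component_self)
    have "strict_mono k \<or> strict_antimono_on UNIV k" using chart_spec(1) True by (simp add: k_def)
    then show ?thesis
    proof
      assume k: "strict_mono k"
      then have "i x < i y" using strict_mono_less[OF k, of "i x" "i y"] i less by simp
      then show ?thesis unfolding a by (intro strict_monoD[OF k] strict_monoD[OF u])
    next
      assume k: "strict_antimono_on UNIV k"
      then have anti: "k s < k t \<longleftrightarrow> t < s" for s t by (rule strict_antimono_less)
      have "i y < i x" using anti[of "i x" "i y"] i less by simp
      then show ?thesis unfolding a anti by (rule strict_monoD[OF u])
    qed
  next
    case False
    have "\<exists>z. x \<le> z \<and> z \<le> y \<and> f z = z"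
    proof (cases "f x = x")
      case True
      then show ?thesis using less by (intro exI[of _ x]) simp
    next
      case False
      then have "y \<notin> moved_component x" using \<open>\<not> (f x \<noteq> x \<and> y \<in> moved_component x)\<close> by blast
      then show ?thesis using less by (auto simp: moved_component_def closed_segment_eq_real_ivl)
    qed
    then obtain z where z: "x \<le> z" "z \<le> y" "f z = z" by blast
    \<comment> \<open>The clause on equality gives strictness: both images can equal
      \<open>z\<close> only if \<open>x = z = y\<close>.\<close>
    have "?a x \<le> z \<and> (?a x = z \<longrightarrow> x = z)"
    proof (cases "f x = x")
      case True
      then show ?thesis using z by (simp add: act_by_charts_def)
    next
      case False
      then have "\<not> z \<le> ?a x"
        using act_by_charts_component[OF False, of u] z by (auto simp: moved_component_def closed_segment_eq_real_ivl split: if_splits)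
      then show ?thesis by simp
    qed
    moreover have "z \<le> ?a y \<and> (?a y = z \<longrightarrow> y = z)"
    proof (cases "f y = y")
      case True
      then show ?thesis using z by (simp add: act_by_charts_def)
    next
      case False
      then have "\<not> ?a y \<le> z"
        using act_by_charts_component[OF False, of u] z by (auto simp: moved_component_def closed_segment_eq_real_ivl split: if_splits)
      then show ?thesis by simp
    qed
    ultimately show ?thesis using less by linarith
  qed
qed

text \<open>Monotonicity and surjectivity yield continuity even at fixed points where components
  accumulate.\<close>

lemma act_by_charts_mem:
  assumes "u \<in> carrier (orientation_preserving homeo_R)"
  shows "act_by_charts u \<in> carrier (orientation_preserving homeo_R)"
proof -
  obtain u' where u': "\<And>x. u (u' x) = x" by (rule Homeo_plus.inverseE[OF assms]) (rule that)
  have "u \<circ> u' = id" using u' by (simp add: fun_eq_iff)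
  then have inv: "act_by_charts u (act_by_charts u' y) = y" for y
    by (simp add: act_by_charts_comp act_by_charts_id)
  have "strict_mono (act_by_charts u)" using assms by (intro strict_mono_act_by_charts) simp
  with strict_mono_surj_homeo_R[OF this inv] show ?thesis
    unfolding carrier_orientation_preserving by blast
qed

lemma act_by_charts_reversible:
  assumes "reversible (orientation_preserving homeo_R) u"
  shows "reversible (orientation_preserving homeo_R) (act_by_charts u)"
proof -
  obtain h where u: "u \<in> carrier (orientation_preserving homeo_R)"
    and h: "h \<in> carrier (orientation_preserving homeo_R)" and rev: "\<And>x. u (h (u x)) = h x"
    using Homeo_plus.reversibleE[OF assms] by blast
  have "u \<circ> (h \<circ> u) = h" using rev by (simp add: fun_eq_iff)
  then show ?thesis
    by (intro Homeo_plus.reversibleI[OF act_by_charts_mem[OF u] act_by_charts_mem[OF h]])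
      (simp add: act_by_charts_comp)
qed

lemma strict_mono_mem_reversible_products_2: "f \<in> reversible_products (orientation_preserving homeo_R) 2"
proof -
  have *: "reversible (orientation_preserving homeo_R) u" if u: "reversible (orientation_preserving PL_R) u" for u
  proof -
    obtain h where "u \<in> carrier (orientation_preserving PL_R)"
      "h \<in> carrier (orientation_preserving PL_R)" "\<And>x. u (h (u x)) = h x"
      using PL_plus.reversibleE[OF u] by blast
    then show ?thesis
      by (intro Homeo_plus.reversibleI[of u h]) (simp_all add: PL_R_iff del: homeo_R_simps)
  qed
  obtain a b where ab: "reversible (orientation_preserving PL_R) a"
    "reversible (orientation_preserving PL_R) b" "\<And>x. a (b x) = x + 1"
    using translation_eq_mult_reversible by blast
  have "a \<circ> b = (\<lambda>x. x + 1)" using ab(3) by (simp add: fun_eq_iff)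
  then have "f = act_by_charts a \<circ> act_by_charts b"
    by (intro ext) (simp only: comp_apply act_by_charts_comp act_by_charts_translation)
  then show ?thesis
    using Homeo_plus.mult_mem_reversible_products_2[OF act_by_charts_reversible[OF *[OF ab(1)]]
        act_by_charts_reversible[OF *[OF ab(2)]]] by simp
qed

end

theorem theorem1p1:
  shows
    "(carrier (orientation_preserving homeo_R) = reversible_products (orientation_preserving homeo_R) 2
        \<and> carrier homeo_R = reversible_products homeo_R 2)
     \<and> (\<forall>n::nat. n \<ge> 1 \<longrightarrow>
          reversible_products (orientation_preserving PLF_R) n = {\<one>\<^bsub>orientation_preserving PLF_R\<^esub>}
          \<and> involution_products PLF_R (2 * n) = reversible_products PLF_R n)
     \<and> (carrier (orientation_preserving PL_R) = reversible_products (orientation_preserving PL_R) 4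
        \<and> carrier PL_R = reversible_products PL_R 2)"
proof -
  interpret PLF_plus: homeo_group "orientation_preserving PLF_R"
    by (rule homeo_group_orientation_preserving[OF homeo_group_PLF_R])
  have "carrier (orientation_preserving homeo_R) = reversible_products (orientation_preserving homeo_R) 2"
    using strict_mono_mem_reversible_products_2 Homeo_plus.reversible_products_subset
    by (auto simp del: homeo_R_simps)
  moreover have "carrier homeo_R = reversible_products homeo_R 2" "carrier PL_R = reversible_products PL_R 2"
    using carrier_subset_reversible_products_2 Homeo.reversible_products_subset PL.reversible_products_subset
    by blast+
  moreover have "carrier (orientation_preserving PL_R) = reversible_products (orientation_preserving PL_R) 4"
    using carrier_PL_plus_subset_reversible_products_4 PL_plus.reversible_products_subset by blast
  moreover have "reversible_products (orientation_preserving PLF_R) n = {\<one>\<^bsub>orientation_preserving PLF_R\<^esub>}" for n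
    by (induction n) (auto simp: PLF_plus.reversible_products_0 PLF_plus.reversible_products_Suc
        reversible_PLF_R_strict_mono)
  moreover have "involution_products PLF_R (2 * n) = reversible_products PLF_R n" for n
    by (rule PLF.involution_products_eq_reversible_products[OF reversible_PLF_R_imp_involutions])
  ultimately show ?thesis by simp
qed

end
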